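(* Let $\mathcal{L}=(L_1,L_2,P,\&_1,\swarrow^1,\nwarrow_1,\dots,\&_n,\swarrow^n,\nwarrow_n)$ be a multi-adjoint property-oriented frame and $(X,Y,\phi)$ a context of $\mathcal{L}$, i.e. sets $X$ (properties), $Y$ (objects), a map $\phi:X\times Y\to P$ and a map $|\cdot|:Y\to\{1,\dots,n\}$. Let $\phi_P:X\to\!\!\!\!\circ\; Y$ be the $\mathcal{Q}_P^{\mathcal{L}}$-relation with $|x|=0$ for $x\in X$, the given types for $y\in Y$, and $\phi_P(x,y)=\phi(x,y)\in\mathcal{Q}_P^{\mathcal{L}}(0,|y|)=P$. Then the multi-adjoint property-oriented concept lattice of $(X,Y,\phi)$ is isomorphic, as a complete lattice, to the $\infty$-fibre $(\mathcal{K}\phi_P)_\infty$ of the complete $\mathcal{Q}_P^{\mathcal{L}}$-category $\mathcal{K}\phi_P$ of fixed points of the Kan adjunction induced by $\phi_P$.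
   Context: Multi-adjoint property-oriented frame: complete lattices $L_1,L_2,P$ and for $i=1,\dots,n$ maps $\&_i:P\times L_2\to L_1$, $\swarrow^i:L_1\times L_2\to P$, $\nwarrow_i:L_1\times P\to L_2$ with $z\,\&_i\,y\le x\iff z\le x\swarrow^i y\iff y\le x\nwarrow_i z$. Quantaloid $\mathcal{Q}_P^{\mathcal{L}}$: objects $0,1,\dots,n,\infty$; $\mathcal{Q}_P^{\mathcal{L}}(0,i)=P$, $\mathcal{Q}_P^{\mathcal{L}}(i,\infty)=L_2$, $\mathcal{Q}_P^{\mathcal{L}}(0,\infty)=L_1$ ($1\le i\le n$); $\mathcal{Q}_P^{\mathcal{L}}(i,i)=\{\bot_{i,i}<\mathrm{id}_i\}$; all other hom-sets one-element; composition $v\circ u=u\,\&_i\,v$ for $u\in P=\mathcal{Q}_P^{\mathcal{L}}(0,i)$, $v\in L_2=\mathcal{Q}_P^{\mathcal{L}}(i,\infty)$, identities act as identities, other composites are bottom. Its left implication (defined by $v\circ u\le w\iff v\le w/u$) satisfies $w/u=w\nwarrow_i u$ for $u\in P$, $w\in L_1$. For a quantaloid $\mathcal{Q}$ and object-typed sets $X,Y$, a $\mathcal{Q}$-relation $\phi$ assigns $\phi(x,y)\in\mathcal{Q}(|x|,|y|)$. Regarding $X,Y$ as discrete $\mathcal{Q}$-categories, a presheaf of type $q$ on $Y$ is a map $\lambda$ with $\lambda(y)\in\mathcal{Q}(|y|,q)$; the presheaf $\mathcal{Q}$-category $\mathcal{P}Y$ has underlying order on presheaves of a fixed type equal to the pointwise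 order. The Kan adjunction $\phi^*\dashv\phi_*:\mathcal{P}X\to\mathcal{P}Y$ is given by $(\phi^*\lambda)(x)=\bigvee_{y\in Y}\lambda(y)\circ\phi(x,y)$ and $(\phi_*\mu)(y)=\bigwedge_{x\in X}\mu(x)/\phi(x,y)$. $\mathcal{K}\phi=\{\lambda\in\mathcal{P}Y\mid\phi_*\phi^*\lambda=\lambda\}$ with inherited structure, and $(\mathcal{K}\phi)_q$ is its set of elements of type $q$ with the underlying (pointwise) order. Concretely, $(\mathcal{K}\phi_P)_\infty=\{\lambda\in L_2^Y\mid \lambda=\phi_*\phi^*\lambda\}$ ordered pointwise, where for $\lambda\in L_2^Y$, $\mu\in L_1^X$: $(\phi^*\lambda)(x)=\bigvee_{y\in Y}\phi(x,y)\,\&_{|y|}\,\lambda(y)$ and $(\phi_*\mu)(y)=\bigwedge_{x\in X}\mu(x)\nwarrow_{|y|}\phi(x,y)$. The multi-adjoint property-oriented concept lattice of $(X,Y,\phi)$ is the complete lattice of fixed points of the Galois connection $\phi^*:L_2^Y\rightleftarrows L_1^X:\phi_*$ (with $\phi^*$ left adjoint for the pointwise orders), i.e. the set of pairs $(\lambda,\mu)\in L_2^Y\times L_1^X$ with $\phi^*\lambda=\mu$ and $\phi_*\mu=\lambda$, ordered by $(\lambda_1,\mu_1)\le(\lambda_2,\mu_2)$ iff $\lambda_1\le\lambda_2$ pointwise (equivalently $\mu_1\le\mu_2$ pointwise). *)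

theory Defs
  imports "HOL-Algebra.Complete_Lattice"
begin

section \<open>Isomorphism of complete lattices\<close>

definition complete_lattice_iso ::
    "('a, 'c) gorder_scheme \<Rightarrow> ('b, 'd) gorder_scheme \<Rightarrow> ('a \<Rightarrow> 'b) \<Rightarrow> bool" where
  "complete_lattice_iso L M f \<longleftrightarrow>
     bij_betw f (carrier L) (carrier M) \<and>
     (\<forall>a\<in>carrier L. \<forall>b\<in>carrier L. a \<sqsubseteq>\<^bsub>L\<^esub> b \<longleftrightarrow> f a \<sqsubseteq>\<^bsub>M\<^esub> f b) \<and>
     sup_pres L M f \<and> inf_pres L M f"

definition complete_lattice_isomorphic ::
    "('a, 'c) gorder_scheme \<Rightarrow> ('b, 'd) gorder_scheme \<Rightarrow> bool" where
  "complete_lattice_isomorphic L M \<longleftrightarrow> (\<exists>f. complete_lattice_iso L M f)"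


section \<open>Quantaloids\<close>

text \<open>
  \<open>Hom Q p q\<close> is the ordered set of arrows from \<open>p\<close> to \<open>q\<close>.  Arrows of different hom-sets may be
  equal as elements of the arrow type, so composition takes the objects as arguments:
  \<open>cmp Q p q r v u\<close> is the composite of \<open>u\<close> in \<open>Hom Q p q\<close> followed by \<open>v\<close> in \<open>Hom Q q r\<close>.
\<close>

record ('o, 'a) quantaloid =
  Obj :: "'o set"
  Hom :: "'o \<Rightarrow> 'o \<Rightarrow> 'a gorder"
  cmp :: "'o \<Rightarrow> 'o \<Rightarrow> 'o \<Rightarrow> 'a \<Rightarrow> 'a \<Rightarrow> 'a"
  idn :: "'o \<Rightarrow> 'a"

locale quantaloid =
  fixes Q :: "('o, 'a) quantaloid"
  assumes hom_complete: "\<lbrakk>p \<in> Obj Q; q \<in> Obj Q\<rbrakk> \<Longrightarrow> complete_lattice (Hom Q p q)"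
    and cmp_closed: "\<lbrakk>p \<in> Obj Q; q \<in> Obj Q; r \<in> Obj Q;
        u \<in> carrier (Hom Q p q); v \<in> carrier (Hom Q q r)\<rbrakk>
        \<Longrightarrow> cmp Q p q r v u \<in> carrier (Hom Q p r)"
    and idn_closed: "p \<in> Obj Q \<Longrightarrow> idn Q p \<in> carrier (Hom Q p p)"
    and cmp_assoc: "\<lbrakk>p \<in> Obj Q; q \<in> Obj Q; r \<in> Obj Q; s \<in> Obj Q;
        u \<in> carrier (Hom Q p q); v \<in> carrier (Hom Q q r); w \<in> carrier (Hom Q r s)\<rbrakk>
        \<Longrightarrow> cmp Q p r s w (cmp Q p q r v u) = cmp Q p q s (cmp Q q r s w v) u"
    and cmp_idn_right: "\<lbrakk>p \<in> Obj Q; q \<in> Obj Q; u \<in> carrier (Hom Q p q)\<rbrakk>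
        \<Longrightarrow> cmp Q p p q u (idn Q p) = u"
    and cmp_idn_left: "\<lbrakk>p \<in> Obj Q; q \<in> Obj Q; u \<in> carrier (Hom Q p q)\<rbrakk>
        \<Longrightarrow> cmp Q p q q (idn Q q) u = u"
    and cmp_sup_right: "\<lbrakk>p \<in> Obj Q; q \<in> Obj Q; r \<in> Obj Q;
        A \<subseteq> carrier (Hom Q p q); v \<in> carrier (Hom Q q r)\<rbrakk>
        \<Longrightarrow> cmp Q p q r v (\<Squnion>\<^bsub>Hom Q p q\<^esub> A) = \<Squnion>\<^bsub>Hom Q p r\<^esub> (cmp Q p q r v ` A)"
    and cmp_sup_left: "\<lbrakk>p \<in> Obj Q; q \<in> Obj Q; r \<in> Obj Q;
        u \<in> carrier (Hom Q p q); B \<subseteq> carrier (Hom Q q r)\<rbrakk>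
        \<Longrightarrow> cmp Q p q r (\<Squnion>\<^bsub>Hom Q q r\<^esub> B) u = \<Squnion>\<^bsub>Hom Q p r\<^esub> ((\<lambda>v. cmp Q p q r v u) ` B)"

text \<open>The left implication \<open>w / u\<close> in \<open>Hom Q q r\<close>, for \<open>u\<close> in \<open>Hom Q p q\<close> and \<open>w\<close> in \<open>Hom Q p r\<close>.\<close>

definition limp :: "('o, 'a) quantaloid \<Rightarrow> 'o \<Rightarrow> 'o \<Rightarrow> 'o \<Rightarrow> 'a \<Rightarrow> 'a \<Rightarrow> 'a" where
  "limp Q p q r w u =
     \<Squnion>\<^bsub>Hom Q q r\<^esub> {v \<in> carrier (Hom Q q r). cmp Q p q r v u \<sqsubseteq>\<^bsub>Hom Q p r\<^esub> w}"


section \<open>Categories enriched in a quantaloid\<close>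

record ('e, 'o, 'a) qcat =
  Elts :: "'e set"
  qtype :: "'e \<Rightarrow> 'o"
  qhom :: "'e \<Rightarrow> 'e \<Rightarrow> 'a"

locale qcategory = quantaloid Q for Q :: "('o, 'a) quantaloid" +
  fixes C :: "('e, 'o, 'a) qcat"
  assumes qtype_closed: "a \<in> Elts C \<Longrightarrow> qtype C a \<in> Obj Q"
    and qhom_closed: "\<lbrakk>a \<in> Elts C; b \<in> Elts C\<rbrakk>
        \<Longrightarrow> qhom C a b \<in> carrier (Hom Q (qtype C a) (qtype C b))"
    and qhom_idn: "a \<in> Elts C
        \<Longrightarrow> idn Q (qtype C a) \<sqsubseteq>\<^bsub>Hom Q (qtype C a) (qtype C a)\<^esub> qhom C a a"
    and qhom_cmp: "\<lbrakk>a \<in> Elts C; b \<in> Elts C; c \<in> Elts C\<rbrakk>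
        \<Longrightarrow> cmp Q (qtype C a) (qtype C b) (qtype C c) (qhom C b c) (qhom C a b)
              \<sqsubseteq>\<^bsub>Hom Q (qtype C a) (qtype C c)\<^esub> qhom C a c"

text \<open>Completeness: every presheaf on the category has a supremum.\<close>

locale complete_qcategory = qcategory Q C for Q :: "('o, 'a) quantaloid" and C :: "('e, 'o, 'a) qcat" +
  assumes sup_exists: "\<lbrakk>q \<in> Obj Q;
      \<And>a. a \<in> Elts C \<Longrightarrow> m a \<in> carrier (Hom Q (qtype C a) q);
      \<And>a b. \<lbrakk>a \<in> Elts C; b \<in> Elts C\<rbrakk> \<Longrightarrow>
        cmp Q (qtype C a) (qtype C b) q (m b) (qhom C a b) \<sqsubseteq>\<^bsub>Hom Q (qtype C a) q\<^esub> m a\<rbrakk>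
      \<Longrightarrow> \<exists>s\<in>Elts C. qtype C s = q \<and>
            (\<forall>b\<in>Elts C. qhom C s b =
               \<Sqinter>\<^bsub>Hom Q q (qtype C b)\<^esub>
                 ((\<lambda>a. limp Q (qtype C a) q (qtype C b) (qhom C a b) (m a)) ` Elts C))"

definition underlying_le ::
    "('o, 'a) quantaloid \<Rightarrow> ('e, 'o, 'a) qcat \<Rightarrow> 'e \<Rightarrow> 'e \<Rightarrow> bool" where
  "underlying_le Q C a b \<longleftrightarrow>
     qtype C a = qtype C b \<and> idn Q (qtype C a) \<sqsubseteq>\<^bsub>Hom Q (qtype C a) (qtype C b)\<^esub> qhom C a b"

definition fibre :: "('o, 'a) quantaloid \<Rightarrow> ('e, 'o, 'a) qcat \<Rightarrow> 'o \<Rightarrow> 'e gorder" where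
  "fibre Q C q =
     \<lparr>carrier = {a \<in> Elts C. qtype C a = q}, eq = (=), le = underlying_le Q C\<rparr>"

text \<open>
  An object-typed set is a set together with a typing map into \<open>Obj Q\<close>.  A presheaf on it, regarded
  as a discrete enriched category, is paired with its type, since the type need not be determined
  by the values.  Presheaves are extensional, so that equality is equality on the underlying set.
\<close>

definition presheaves ::
    "('o, 'a) quantaloid \<Rightarrow> 'y set \<Rightarrow> ('y \<Rightarrow> 'o) \<Rightarrow> ('o \<times> ('y \<Rightarrow> 'a)) set" where
  "presheaves Q Y tY =
     {(q, l). q \<in> Obj Q \<and> l \<in> (\<Pi>\<^sub>E y\<in>Y. carrier (Hom Q (tY y) q))}"

definition presheaf_qcat ::
    "('o, 'a) quantaloid \<Rightarrow> 'y set \<Rightarrow> ('y \<Rightarrow> 'o) \<Rightarrow> ('o \<times> ('y \<Rightarrow> 'a), 'o, 'a) qcat" where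
  "presheaf_qcat Q Y tY =
     \<lparr>Elts = presheaves Q Y tY,
      qtype = fst,
      qhom = (\<lambda>(q, l) (r, m). \<Sqinter>\<^bsub>Hom Q q r\<^esub> ((\<lambda>y. limp Q (tY y) q r (m y) (l y)) ` Y))\<rparr>"


section \<open>The Kan adjunction of a relation and its fixed points\<close>

definition qrelation ::
    "('o, 'a) quantaloid \<Rightarrow> 'x set \<Rightarrow> ('x \<Rightarrow> 'o) \<Rightarrow> 'y set \<Rightarrow> ('y \<Rightarrow> 'o) \<Rightarrow> ('x \<Rightarrow> 'y \<Rightarrow> 'a) \<Rightarrow> bool" where
  "qrelation Q X tX Y tY f \<longleftrightarrow>
     tX \<in> X \<rightarrow> Obj Q \<and> tY \<in> Y \<rightarrow> Obj Q \<and>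
     (\<forall>x\<in>X. \<forall>y\<in>Y. f x y \<in> carrier (Hom Q (tX x) (tY y)))"

definition kan_star ::
    "('o, 'a) quantaloid \<Rightarrow> 'x set \<Rightarrow> ('x \<Rightarrow> 'o) \<Rightarrow> 'y set \<Rightarrow> ('y \<Rightarrow> 'o) \<Rightarrow> ('x \<Rightarrow> 'y \<Rightarrow> 'a)
      \<Rightarrow> 'o \<times> ('y \<Rightarrow> 'a) \<Rightarrow> 'o \<times> ('x \<Rightarrow> 'a)" where
  "kan_star Q X tX Y tY f = (\<lambda>(q, l).
     (q, \<lambda>x\<in>X. \<Squnion>\<^bsub>Hom Q (tX x) q\<^esub> ((\<lambda>y. cmp Q (tX x) (tY y) q (l y) (f x y)) ` Y)))"

definition kan_lower ::
    "('o, 'a) quantaloid \<Rightarrow> 'x set \<Rightarrow> ('x \<Rightarrow> 'o) \<Rightarrow> 'y set \<Rightarrow> ('y \<Rightarrow> 'o) \<Rightarrow> ('x \<Rightarrow> 'y \<Rightarrow> 'a)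
      \<Rightarrow> 'o \<times> ('x \<Rightarrow> 'a) \<Rightarrow> 'o \<times> ('y \<Rightarrow> 'a)" where
  "kan_lower Q X tX Y tY f = (\<lambda>(q, m).
     (q, \<lambda>y\<in>Y. \<Sqinter>\<^bsub>Hom Q (tY y) q\<^esub> ((\<lambda>x. limp Q (tX x) (tY y) q (m x) (f x y)) ` X)))"

definition kan_fixed ::
    "('o, 'a) quantaloid \<Rightarrow> 'x set \<Rightarrow> ('x \<Rightarrow> 'o) \<Rightarrow> 'y set \<Rightarrow> ('y \<Rightarrow> 'o) \<Rightarrow> ('x \<Rightarrow> 'y \<Rightarrow> 'a)
      \<Rightarrow> ('o \<times> ('y \<Rightarrow> 'a), 'o, 'a) qcat" where
  "kan_fixed Q X tX Y tY f =
     (presheaf_qcat Q Y tY)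
       \<lparr>Elts := {l \<in> presheaves Q Y tY. kan_lower Q X tX Y tY f (kan_star Q X tX Y tY f l) = l}\<rparr>"


subsection \<open>The category of fixed points is complete\<close>

context quantaloid
begin

lemma hom_po: "p \<in> Obj Q \<Longrightarrow> q \<in> Obj Q \<Longrightarrow> partial_order (Hom Q p q)"
  using hom_complete complete_lattice.axioms(1) by blast

lemma hom_refl: "\<lbrakk>p \<in> Obj Q; q \<in> Obj Q; u \<in> carrier (Hom Q p q)\<rbrakk> \<Longrightarrow> u \<sqsubseteq>\<^bsub>Hom Q p q\<^esub> u"
  by (meson hom_po partial_order.axioms(1) weak_partial_order.le_refl)

lemma hom_trans: "\<lbrakk>u \<sqsubseteq>\<^bsub>Hom Q p q\<^esub> v; v \<sqsubseteq>\<^bsub>Hom Q p q\<^esub> w; p \<in> Obj Q; q \<in> Obj Q;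
    u \<in> carrier (Hom Q p q); v \<in> carrier (Hom Q p q); w \<in> carrier (Hom Q p q)\<rbrakk>
    \<Longrightarrow> u \<sqsubseteq>\<^bsub>Hom Q p q\<^esub> w"
  by (meson hom_po partial_order.axioms(1) weak_partial_order.le_trans)

lemma hom_antisym: "\<lbrakk>u \<sqsubseteq>\<^bsub>Hom Q p q\<^esub> v; v \<sqsubseteq>\<^bsub>Hom Q p q\<^esub> u; p \<in> Obj Q; q \<in> Obj Q;
    u \<in> carrier (Hom Q p q); v \<in> carrier (Hom Q p q)\<rbrakk> \<Longrightarrow> u = v"
  by (meson hom_po partial_order.le_antisym)

lemma hom_sup_closed: "\<lbrakk>p \<in> Obj Q; q \<in> Obj Q; A \<subseteq> carrier (Hom Q p q)\<rbrakk>
    \<Longrightarrow> \<Squnion>\<^bsub>Hom Q p q\<^esub> A \<in> carrier (Hom Q p q)"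
proof -
  assume a: "p \<in> Obj Q" "q \<in> Obj Q" "A \<subseteq> carrier (Hom Q p q)"
  interpret H: complete_lattice "Hom Q p q" using a hom_complete by blast
  show ?thesis using a by simp
qed

lemma hom_inf_closed: "\<lbrakk>p \<in> Obj Q; q \<in> Obj Q; A \<subseteq> carrier (Hom Q p q)\<rbrakk>
    \<Longrightarrow> \<Sqinter>\<^bsub>Hom Q p q\<^esub> A \<in> carrier (Hom Q p q)"
proof -
  assume a: "p \<in> Obj Q" "q \<in> Obj Q" "A \<subseteq> carrier (Hom Q p q)"
  interpret H: complete_lattice "Hom Q p q" using a hom_complete by blast
  show ?thesis using a by simp
qed

lemma sup_le_iff:
  assumes "p \<in> Obj Q" "q \<in> Obj Q" "A \<subseteq> carrier (Hom Q p q)" "w \<in> carrier (Hom Q p q)"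
  shows "\<Squnion>\<^bsub>Hom Q p q\<^esub> A \<sqsubseteq>\<^bsub>Hom Q p q\<^esub> w \<longleftrightarrow> (\<forall>a\<in>A. a \<sqsubseteq>\<^bsub>Hom Q p q\<^esub> w)"
proof -
  interpret H: complete_lattice "Hom Q p q" using assms hom_complete by blast
  show ?thesis
    using assms by (meson H.le_trans H.sup_closed H.sup_least H.sup_upper subsetD)
qed

lemma le_inf_iff:
  assumes "p \<in> Obj Q" "q \<in> Obj Q" "A \<subseteq> carrier (Hom Q p q)" "w \<in> carrier (Hom Q p q)"
  shows "w \<sqsubseteq>\<^bsub>Hom Q p q\<^esub> \<Sqinter>\<^bsub>Hom Q p q\<^esub> A \<longleftrightarrow> (\<forall>a\<in>A. w \<sqsubseteq>\<^bsub>Hom Q p q\<^esub> a)"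
proof -
  interpret H: complete_lattice "Hom Q p q" using assms hom_complete by blast
  show ?thesis
    using assms by (meson H.le_trans H.inf_closed H.inf_greatest H.inf_lower subsetD)
qed

lemma sup_pair:
  assumes "p \<in> Obj Q" "q \<in> Obj Q" "u \<in> carrier (Hom Q p q)" "u' \<in> carrier (Hom Q p q)"
    "u \<sqsubseteq>\<^bsub>Hom Q p q\<^esub> u'"
  shows "\<Squnion>\<^bsub>Hom Q p q\<^esub> {u, u'} = u'"
proof -
  interpret H: complete_lattice "Hom Q p q" using assms hom_complete by blast
  have "{u, u'} \<subseteq> carrier (Hom Q p q)" using assms by simp
  then show ?thesis
    using assms by (intro H.le_antisym H.sup_least H.sup_upper H.sup_closed) auto
qed

lemma cmp_mono_left:
  assumes o: "p \<in> Obj Q" "q \<in> Obj Q" "r \<in> Obj Q"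
    and "u \<in> carrier (Hom Q p q)" "v \<in> carrier (Hom Q q r)" "v' \<in> carrier (Hom Q q r)"
    "v \<sqsubseteq>\<^bsub>Hom Q q r\<^esub> v'"
  shows "cmp Q p q r v u \<sqsubseteq>\<^bsub>Hom Q p r\<^esub> cmp Q p q r v' u"
proof -
  have "cmp Q p q r v' u = \<Squnion>\<^bsub>Hom Q p r\<^esub> {cmp Q p q r v u, cmp Q p q r v' u}"
    using cmp_sup_left[of p q r u "{v, v'}"] sup_pair assms by simp
  then show ?thesis
    using sup_le_iff[of p r "{cmp Q p q r v u, cmp Q p q r v' u}" "cmp Q p q r v' u"]
      assms cmp_closed hom_refl by simp
qed

lemma cmp_mono_right:
  assumes o: "p \<in> Obj Q" "q \<in> Obj Q" "r \<in> Obj Q"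
    and "v \<in> carrier (Hom Q q r)" "u \<in> carrier (Hom Q p q)" "u' \<in> carrier (Hom Q p q)"
    "u \<sqsubseteq>\<^bsub>Hom Q p q\<^esub> u'"
  shows "cmp Q p q r v u \<sqsubseteq>\<^bsub>Hom Q p r\<^esub> cmp Q p q r v u'"
proof -
  have "cmp Q p q r v u' = \<Squnion>\<^bsub>Hom Q p r\<^esub> {cmp Q p q r v u, cmp Q p q r v u'}"
    using cmp_sup_right[of p q r "{u, u'}" v] sup_pair assms by simp
  then show ?thesis
    using sup_le_iff[of p r "{cmp Q p q r v u, cmp Q p q r v u'}" "cmp Q p q r v u'"]
      assms cmp_closed hom_refl by simp
qed

lemma limp_closed:
  "\<lbrakk>q \<in> Obj Q; r \<in> Obj Q\<rbrakk> \<Longrightarrow> limp Q p q r w u \<in> carrier (Hom Q q r)"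
  unfolding limp_def by (rule hom_sup_closed) auto

lemma limp_adj:
  assumes o: "p \<in> Obj Q" "q \<in> Obj Q" "r \<in> Obj Q"
    and c: "u \<in> carrier (Hom Q p q)" "v \<in> carrier (Hom Q q r)" "w \<in> carrier (Hom Q p r)"
  shows "v \<sqsubseteq>\<^bsub>Hom Q q r\<^esub> limp Q p q r w u \<longleftrightarrow> cmp Q p q r v u \<sqsubseteq>\<^bsub>Hom Q p r\<^esub> w"
proof
  let ?B = "{v \<in> carrier (Hom Q q r). cmp Q p q r v u \<sqsubseteq>\<^bsub>Hom Q p r\<^esub> w}"
  have B: "?B \<subseteq> carrier (Hom Q q r)" by auto
  have le: "cmp Q p q r (limp Q p q r w u) u \<sqsubseteq>\<^bsub>Hom Q p r\<^esub> w"
    unfolding limp_def cmp_sup_left[OF o c(1) B]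
    using c cmp_closed[OF o c(1)] by (subst sup_le_iff[OF o(1,3)]) auto
  show "cmp Q p q r v u \<sqsubseteq>\<^bsub>Hom Q p r\<^esub> w" if "v \<sqsubseteq>\<^bsub>Hom Q q r\<^esub> limp Q p q r w u"
    by (rule hom_trans[OF cmp_mono_left[OF o c(1,2) limp_closed[OF o(2,3)] that] le o(1,3)
          cmp_closed[OF o c(1,2)] cmp_closed[OF o c(1) limp_closed[OF o(2,3)]] c(3)])
  show "v \<sqsubseteq>\<^bsub>Hom Q q r\<^esub> limp Q p q r w u" if "cmp Q p q r v u \<sqsubseteq>\<^bsub>Hom Q p r\<^esub> w"
    using sup_le_iff[OF o(2,3) B limp_closed[OF o(2,3), of p w u]] hom_refl[OF o(2,3) limp_closed[OF o(2,3), of p w u]] that c(2)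
    unfolding limp_def by blast
qed

lemma hom_eqI:
  assumes "p \<in> Obj Q" "q \<in> Obj Q" "u \<in> carrier (Hom Q p q)" "v \<in> carrier (Hom Q p q)"
    and "\<And>w. w \<in> carrier (Hom Q p q) \<Longrightarrow> w \<sqsubseteq>\<^bsub>Hom Q p q\<^esub> u \<longleftrightarrow> w \<sqsubseteq>\<^bsub>Hom Q p q\<^esub> v"
  shows "u = v"
  by (rule hom_antisym) (use assms hom_refl[OF assms(1,2)] in auto)

context
  fixes Y :: "'y set" and tY :: "'y \<Rightarrow> 'o"
  assumes tY: "tY \<in> Y \<rightarrow> Obj Q"
begin

lemma presheafD:
  "(q, l) \<in> presheaves Q Y tY \<Longrightarrow> q \<in> Obj Q"
  "(q, l) \<in> presheaves Q Y tY \<Longrightarrow> y \<in> Y \<Longrightarrow> l y \<in> carrier (Hom Q (tY y) q)"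
  by (auto simp: presheaves_def)

lemma tYD: "y \<in> Y \<Longrightarrow> tY y \<in> Obj Q"
  using tY by auto

abbreviation "phom \<equiv> qhom (presheaf_qcat Q Y tY)"

lemma phom_closed:
  assumes "(q, l) \<in> presheaves Q Y tY" "(r, m) \<in> presheaves Q Y tY"
  shows "phom (q, l) (r, m) \<in> carrier (Hom Q q r)"
  unfolding presheaf_qcat_def using assms presheafD(1)
  by (auto intro!: hom_inf_closed limp_closed)

lemma le_phom:
  assumes "(q, l) \<in> presheaves Q Y tY" "(r, m) \<in> presheaves Q Y tY" "v \<in> carrier (Hom Q q r)"
  shows "v \<sqsubseteq>\<^bsub>Hom Q q r\<^esub> phom (q, l) (r, m) \<longleftrightarrow>
    (\<forall>y\<in>Y. cmp Q (tY y) q r v (l y) \<sqsubseteq>\<^bsub>Hom Q (tY y) r\<^esub> m y)"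
proof -
  have o: "q \<in> Obj Q" "r \<in> Obj Q" using assms presheafD by blast+
  have "v \<sqsubseteq>\<^bsub>Hom Q q r\<^esub> phom (q, l) (r, m) \<longleftrightarrow>
      (\<forall>y\<in>Y. v \<sqsubseteq>\<^bsub>Hom Q q r\<^esub> limp Q (tY y) q r (m y) (l y))"
    unfolding presheaf_qcat_def using o assms(3)
    by (auto simp: le_inf_iff limp_closed image_subset_iff)
  also have "\<dots> \<longleftrightarrow> (\<forall>y\<in>Y. cmp Q (tY y) q r v (l y) \<sqsubseteq>\<^bsub>Hom Q (tY y) r\<^esub> m y)"
    using o assms presheafD tYD by (intro ball_cong refl limp_adj) auto
  finally show ?thesis .
qed

lemma phom_cmp_le:
  assumes "(q, l) \<in> presheaves Q Y tY" "(r, m) \<in> presheaves Q Y tY" "y \<in> Y"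
  shows "cmp Q (tY y) q r (phom (q, l) (r, m)) (l y) \<sqsubseteq>\<^bsub>Hom Q (tY y) r\<^esub> m y"
  using le_phom[OF assms(1,2) phom_closed[OF assms(1,2)]] assms
    hom_refl[OF _ _ phom_closed[OF assms(1,2)]] presheafD(1) by blast

lemma qcategory_presheaf: "qcategory Q (presheaf_qcat Q Y tY)"
proof (unfold_locales)
  fix a assume "a \<in> Elts (presheaf_qcat Q Y tY)"
  then obtain q l where a: "a = (q, l)" "(q, l) \<in> presheaves Q Y tY"
    by (cases a) (auto simp: presheaf_qcat_def)
  then show "qtype (presheaf_qcat Q Y tY) a \<in> Obj Q"
    by (simp add: presheaf_qcat_def presheafD)
  have "idn Q q \<sqsubseteq>\<^bsub>Hom Q q q\<^esub> phom (q, l) (q, l)"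
    using a presheafD tYD by (subst le_phom) (auto simp: idn_closed cmp_idn_left hom_refl)
  then show "idn Q (qtype (presheaf_qcat Q Y tY) a)
      \<sqsubseteq>\<^bsub>Hom Q (qtype (presheaf_qcat Q Y tY) a) (qtype (presheaf_qcat Q Y tY) a)\<^esub> phom a a"
    using a by (simp add: presheaf_qcat_def)
next
  fix a b assume "a \<in> Elts (presheaf_qcat Q Y tY)" "b \<in> Elts (presheaf_qcat Q Y tY)"
  then obtain q l r m where a: "a = (q, l)" "(q, l) \<in> presheaves Q Y tY" "b = (r, m)"
      "(r, m) \<in> presheaves Q Y tY"
    by (cases a, cases b) (auto simp: presheaf_qcat_def)
  then show "phom a b \<in> carrier (Hom Q (qtype (presheaf_qcat Q Y tY) a)
      (qtype (presheaf_qcat Q Y tY) b))"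
    using phom_closed by (simp add: presheaf_qcat_def)
next
  fix a b c assume "a \<in> Elts (presheaf_qcat Q Y tY)" "b \<in> Elts (presheaf_qcat Q Y tY)"
    "c \<in> Elts (presheaf_qcat Q Y tY)"
  then obtain q l r m s k where a: "a = (q, l)" "b = (r, m)" "c = (s, k)"
      and P: "(q, l) \<in> presheaves Q Y tY" "(r, m) \<in> presheaves Q Y tY"
      "(s, k) \<in> presheaves Q Y tY"
    by (cases a, cases b, cases c) (auto simp: presheaf_qcat_def)
  note o = P[THEN presheafD(1)]
  note pc = phom_closed[OF P(1,2)] phom_closed[OF P(2,3)]
  have "cmp Q q r s (phom (r, m) (s, k)) (phom (q, l) (r, m))
      \<sqsubseteq>\<^bsub>Hom Q q s\<^esub> phom (q, l) (s, k)"
  proof (subst le_phom[OF P(1,3) cmp_closed[OF o pc]], rule ballI)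
    fix y assume y: "y \<in> Y"
    note e = tYD[OF y] presheafD(2)[OF P(1) y] presheafD(2)[OF P(2) y] presheafD(2)[OF P(3) y]
    have "cmp Q (tY y) q s (cmp Q q r s (phom (r, m) (s, k)) (phom (q, l) (r, m))) (l y) =
      cmp Q (tY y) r s (phom (r, m) (s, k)) (cmp Q (tY y) q r (phom (q, l) (r, m)) (l y))"
      using o e pc by (simp add: cmp_assoc)
    moreover have "cmp Q (tY y) r s (phom (r, m) (s, k)) (cmp Q (tY y) q r (phom (q, l) (r, m)) (l y))
      \<sqsubseteq>\<^bsub>Hom Q (tY y) s\<^esub> cmp Q (tY y) r s (phom (r, m) (s, k)) (m y)"
      using o e pc phom_cmp_le[OF P(1,2) y] by (intro cmp_mono_right) (auto intro: cmp_closed)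
    ultimately show "cmp Q (tY y) q s (cmp Q q r s (phom (r, m) (s, k)) (phom (q, l) (r, m))) (l y)
      \<sqsubseteq>\<^bsub>Hom Q (tY y) s\<^esub> k y"
      using hom_trans[OF _ phom_cmp_le[OF P(2,3) y] e(1) o(3)
          cmp_closed[OF e(1) o(2,3) cmp_closed[OF e(1) o(1,2) e(2) pc(1)] pc(2)]
          cmp_closed[OF e(1) o(2,3) e(3) pc(2)] e(4)] by simp
  qed
  then show "cmp Q (qtype (presheaf_qcat Q Y tY) a) (qtype (presheaf_qcat Q Y tY) b)
      (qtype (presheaf_qcat Q Y tY) c) (phom b c) (phom a b)
      \<sqsubseteq>\<^bsub>Hom Q (qtype (presheaf_qcat Q Y tY) a) (qtype (presheaf_qcat Q Y tY) c)\<^esub> phom a c"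
    using a by (simp add: presheaf_qcat_def)
qed

end

lemma complete_qcategory_kan_fixed:
  fixes X :: "'x set" and Y :: "'y set"
  assumes R: "qrelation Q X tX Y tY f"
  shows "complete_qcategory Q (kan_fixed Q X tX Y tY f)"
proof -
  have tX: "x \<in> X \<Longrightarrow> tX x \<in> Obj Q" and tYs: "tY \<in> Y \<rightarrow> Obj Q"
    and f: "x \<in> X \<Longrightarrow> y \<in> Y \<Longrightarrow> f x y \<in> carrier (Hom Q (tX x) (tY y))" for x y
    using R by (auto simp: qrelation_def)
  have tY: "y \<in> Y \<Longrightarrow> tY y \<in> Obj Q" for y using tYs by auto
  let ?K = "kan_fixed Q X tX Y tY f" and ?P = "presheaf_qcat Q Y tY"
  let ?up = "\<lambda>q (l :: 'y \<Rightarrow> 'a) (x :: 'x). \<Squnion>\<^bsub>Hom Q (tX x) q\<^esub> ((\<lambda>y. cmp Q (tX x) (tY y) q (l y) (f x y)) ` Y)"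
  define \<rho> where "\<rho> q l = (\<lambda>y\<in>Y. \<Sqinter>\<^bsub>Hom Q (tY y) q\<^esub>
     ((\<lambda>x. limp Q (tX x) (tY y) q (?up q l x) (f x y)) ` X))" for q and l :: "'y \<Rightarrow> 'a"
  have comp: "kan_lower Q X tX Y tY f (kan_star Q X tX Y tY f (q, l)) = (q, \<rho> q l)" for q l
    by (auto simp: kan_lower_def kan_star_def \<rho>_def intro!: restrict_ext arg_cong2[where f = inf])
  have K_elts: "a \<in> Elts ?K \<longleftrightarrow> a \<in> presheaves Q Y tY \<and> \<rho> (fst a) (snd a) = snd a" for a
    by (cases a) (auto simp: kan_fixed_def comp)
  have K_hom: "qhom ?K = qhom ?P" and K_type: "qtype ?K = fst"
    by (simp_all add: kan_fixed_def presheaf_qcat_def)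
  note pD = presheafD[OF tYs]
  have up_closed: "?up q l x \<in> carrier (Hom Q (tX x) q)"
    if "(q, l) \<in> presheaves Q Y tY" "x \<in> X" for q l x
    using that f tX tY pD by (intro hom_sup_closed) (auto intro!: cmp_closed)
  have rho_closed: "(q, \<rho> q l) \<in> presheaves Q Y tY" if "(q, l) \<in> presheaves Q Y tY" for q l
    using that tY pD(1)[OF that] by (auto simp: presheaves_def \<rho>_def intro!: hom_inf_closed limp_closed)
  \<comment> \<open>the universal property of the closure operator\<close>
  have le_rho: "v \<sqsubseteq>\<^bsub>Hom Q (tY y) q\<^esub> \<rho> q l y \<longleftrightarrow>
      (\<forall>x\<in>X. cmp Q (tX x) (tY y) q v (f x y) \<sqsubseteq>\<^bsub>Hom Q (tX x) q\<^esub> ?up q l x)"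
    if l: "(q, l) \<in> presheaves Q Y tY" and y: "y \<in> Y" and v: "v \<in> carrier (Hom Q (tY y) q)" for q l v y
  proof -
    have "v \<sqsubseteq>\<^bsub>Hom Q (tY y) q\<^esub> \<rho> q l y \<longleftrightarrow>
        (\<forall>x\<in>X. v \<sqsubseteq>\<^bsub>Hom Q (tY y) q\<^esub> limp Q (tX x) (tY y) q (?up q l x) (f x y))"
      unfolding \<rho>_def using y v tY pD(1)[OF l]
      by (simp add: le_inf_iff limp_closed image_subset_iff)
    also have "\<dots> \<longleftrightarrow> (\<forall>x\<in>X. cmp Q (tX x) (tY y) q v (f x y) \<sqsubseteq>\<^bsub>Hom Q (tX x) q\<^esub> ?up q l x)"
      using y v tY tX pD(1)[OF l] f up_closed[OF l] by (intro ball_cong refl limp_adj) auto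
    finally show ?thesis .
  qed
  have up_le: "?up q l x \<sqsubseteq>\<^bsub>Hom Q (tX x) q\<^esub> w \<longleftrightarrow>
      (\<forall>y\<in>Y. cmp Q (tX x) (tY y) q (l y) (f x y) \<sqsubseteq>\<^bsub>Hom Q (tX x) q\<^esub> w)"
    if l: "(q, l) \<in> presheaves Q Y tY" and x: "x \<in> X" and w: "w \<in> carrier (Hom Q (tX x) q)" for q l x w
  proof -
    have "(\<lambda>y. cmp Q (tX x) (tY y) q (l y) (f x y)) ` Y \<subseteq> carrier (Hom Q (tX x) q)"
      using x f tX tY pD[OF l] by (auto intro!: cmp_closed)
    then show ?thesis using sup_le_iff[OF tX[OF x] pD(1)[OF l] _ w] by simp
  qed
  have rho_incr: "l y \<sqsubseteq>\<^bsub>Hom Q (tY y) q\<^esub> \<rho> q l y"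
    if l: "(q, l) \<in> presheaves Q Y tY" and y: "y \<in> Y" for q l y
    using up_le[OF l _ up_closed[OF l]] hom_refl[OF tX pD(1)[OF l] up_closed[OF l]] y
    by (subst le_rho[OF l y pD(2)[OF l y]]) blast
  have rho_cmp_le: "cmp Q (tX x) (tY y) q (\<rho> q l y) (f x y) \<sqsubseteq>\<^bsub>Hom Q (tX x) q\<^esub> ?up q l x"
    if l: "(q, l) \<in> presheaves Q Y tY" and y: "y \<in> Y" and x: "x \<in> X" for q l y x
    using le_rho[OF l y pD(2)[OF rho_closed[OF l] y]]
      hom_refl[OF tY[OF y] pD(1)[OF l] pD(2)[OF rho_closed[OF l] y]] x by blast
  have refl_hom: "qhom ?P (q, \<rho> q l) (r, b) = qhom ?P (q, l) (r, b)"
    if l: "(q, l) \<in> presheaves Q Y tY" and b: "(r, b) \<in> presheaves Q Y tY" and fp: "\<rho> r b = b"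
    for q l r b
  proof (rule hom_eqI[OF pD(1)[OF l] pD(1)[OF b] phom_closed[OF tYs rho_closed[OF l] b]
        phom_closed[OF tYs l b]])
    fix v assume v: "v \<in> carrier (Hom Q q r)"
    note o = pD(1)[OF l] pD(1)[OF b]
    have "(\<forall>y\<in>Y. cmp Q (tY y) q r v (\<rho> q l y) \<sqsubseteq>\<^bsub>Hom Q (tY y) r\<^esub> b y) \<longleftrightarrow>
        (\<forall>y\<in>Y. cmp Q (tY y) q r v (l y) \<sqsubseteq>\<^bsub>Hom Q (tY y) r\<^esub> b y)" (is "?L \<longleftrightarrow> ?R")
    proof
      assume L: ?L
      show ?R
      proof
        fix y assume y: "y \<in> Y"
        note c = pD(2)[OF l y] pD(2)[OF rho_closed[OF l] y] pD(2)[OF b y]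
        show "cmp Q (tY y) q r v (l y) \<sqsubseteq>\<^bsub>Hom Q (tY y) r\<^esub> b y"
          by (rule hom_trans[OF cmp_mono_right[OF tY[OF y] o v c(1,2) rho_incr[OF l y]]
                L[rule_format, OF y] tY[OF y] o(2) cmp_closed[OF tY[OF y] o c(1) v]
                cmp_closed[OF tY[OF y] o c(2) v] c(3)])
      qed
    next
      assume R: ?R
      show ?L
      proof
        fix y assume y: "y \<in> Y"
        note c = pD(2)[OF l y] pD(2)[OF rho_closed[OF l] y] pD(2)[OF b y]
        have "cmp Q (tY y) q r v (\<rho> q l y) \<sqsubseteq>\<^bsub>Hom Q (tY y) r\<^esub> \<rho> r b y"
        proof (subst le_rho[OF b y cmp_closed[OF tY[OF y] o c(2) v]], rule ballI)
          fix x assume x: "x \<in> X"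
          note x' = tX[OF x]
          let ?\<phi> = "f x y"
          have 1: "cmp Q (tX x) (tY y) r (cmp Q (tY y) q r v (\<rho> q l y)) ?\<phi> =
              cmp Q (tX x) q r v (cmp Q (tX x) (tY y) q (\<rho> q l y) ?\<phi>)"
            using cmp_assoc[OF x' tY[OF y] o f[OF x y] c(2) v] by simp
          have 2: "cmp Q (tX x) q r v (cmp Q (tX x) (tY y) q (\<rho> q l y) ?\<phi>)
              \<sqsubseteq>\<^bsub>Hom Q (tX x) r\<^esub> cmp Q (tX x) q r v (?up q l x)"
            by (rule cmp_mono_right[OF x' o v cmp_closed[OF x' tY[OF y] o(1) f[OF x y] c(2)]
                  up_closed[OF l x] rho_cmp_le[OF l y x]])
          have up_sub: "(\<lambda>y. cmp Q (tX x) (tY y) q (l y) (f x y)) ` Y \<subseteq> carrier (Hom Q (tX x) q)"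
            using x f tX tY pD[OF l] by (auto intro!: cmp_closed)
          have 3: "cmp Q (tX x) q r v (?up q l x) \<sqsubseteq>\<^bsub>Hom Q (tX x) r\<^esub> ?up r b x"
          proof (subst cmp_sup_right[OF x' o up_sub v], subst sup_le_iff[OF x' o(2)])
            show "cmp Q (tX x) q r v ` (\<lambda>y. cmp Q (tX x) (tY y) q (l y) (f x y)) ` Y
                \<subseteq> carrier (Hom Q (tX x) r)"
              using cmp_closed[OF x' o subsetD[OF up_sub] v] by blast
            show "?up r b x \<in> carrier (Hom Q (tX x) r)" by (rule up_closed[OF b x])
            show "\<forall>a\<in>cmp Q (tX x) q r v ` (\<lambda>y. cmp Q (tX x) (tY y) q (l y) (f x y)) ` Y.
                a \<sqsubseteq>\<^bsub>Hom Q (tX x) r\<^esub> ?up r b x"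
            proof (clarsimp)
              fix z assume z: "z \<in> Y"
              note d = pD(2)[OF l z] pD(2)[OF b z]
              have "cmp Q (tX x) q r v (cmp Q (tX x) (tY z) q (l z) (f x z)) =
                  cmp Q (tX x) (tY z) r (cmp Q (tY z) q r v (l z)) (f x z)"
                using cmp_assoc[OF x' tY[OF z] o f[OF x z] d(1) v] by simp
              moreover have "cmp Q (tX x) (tY z) r (cmp Q (tY z) q r v (l z)) (f x z)
                  \<sqsubseteq>\<^bsub>Hom Q (tX x) r\<^esub> cmp Q (tX x) (tY z) r (b z) (f x z)"
                by (rule cmp_mono_left[OF x' tY[OF z] o(2) f[OF x z]
                      cmp_closed[OF tY[OF z] o d(1) v] d(2) R[rule_format, OF z]])
              moreover have "cmp Q (tX x) (tY z) r (b z) (f x z) \<sqsubseteq>\<^bsub>Hom Q (tX x) r\<^esub> ?up r b x"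
                using up_le[OF b x up_closed[OF b x]] hom_refl[OF x' o(2) up_closed[OF b x]] z by blast
              ultimately show "cmp Q (tX x) q r v (cmp Q (tX x) (tY z) q (l z) (f x z))
                  \<sqsubseteq>\<^bsub>Hom Q (tX x) r\<^esub> ?up r b x"
                using hom_trans[OF _ _ x' o(2)
                    cmp_closed[OF x' tY[OF z] o(2) f[OF x z] cmp_closed[OF tY[OF z] o d(1) v]]
                    cmp_closed[OF x' tY[OF z] o(2) f[OF x z] d(2)] up_closed[OF b x]] by simp
            qed
          qed
          show "cmp Q (tX x) (tY y) r (cmp Q (tY y) q r v (\<rho> q l y)) ?\<phi>
              \<sqsubseteq>\<^bsub>Hom Q (tX x) r\<^esub> ?up r b x"
            unfolding 1
            by (rule hom_trans[OF 2 3 x' o(2)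
                  cmp_closed[OF x' o cmp_closed[OF x' tY[OF y] o(1) f[OF x y] c(2)] v]
                  cmp_closed[OF x' o up_closed[OF l x] v] up_closed[OF b x]])
        qed
        then show "cmp Q (tY y) q r v (\<rho> q l y) \<sqsubseteq>\<^bsub>Hom Q (tY y) r\<^esub> b y" using fp by simp
      qed
    qed
    then show "v \<sqsubseteq>\<^bsub>Hom Q q r\<^esub> qhom ?P (q, \<rho> q l) (r, b) \<longleftrightarrow> v \<sqsubseteq>\<^bsub>Hom Q q r\<^esub> qhom ?P (q, l) (r, b)"
      using le_phom[OF tYs rho_closed[OF l] b v] le_phom[OF tYs l b v] by simp
  qed
  have mono_up: "?up q l x \<sqsubseteq>\<^bsub>Hom Q (tX x) q\<^esub> ?up q l x" if "(q, l) \<in> presheaves Q Y tY" "x \<in> X" for q l x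
    using hom_refl[OF tX[OF that(2)] pD(1)[OF that(1)] up_closed[OF that]] .
  have idem: "\<rho> q (\<rho> q l) = \<rho> q l" if l: "(q, l) \<in> presheaves Q Y tY" for q l
  proof (rule extensionalityI[where A = Y])
    show "\<rho> q (\<rho> q l) \<in> extensional Y" "\<rho> q l \<in> extensional Y" by (simp_all add: \<rho>_def)
    note l' = rho_closed[OF l]
    have eq: "?up q (\<rho> q l) x = ?up q l x" if x: "x \<in> X" for x
    proof (rule hom_antisym[OF _ _ tX[OF x] pD(1)[OF l] up_closed[OF l' x] up_closed[OF l x]])
      show "?up q (\<rho> q l) x \<sqsubseteq>\<^bsub>Hom Q (tX x) q\<^esub> ?up q l x"
        using up_le[OF l' x up_closed[OF l x]] rho_cmp_le[OF l _ x] by blast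
      show "?up q l x \<sqsubseteq>\<^bsub>Hom Q (tX x) q\<^esub> ?up q (\<rho> q l) x"
      proof (subst up_le[OF l x up_closed[OF l' x]], rule ballI)
        fix y assume y: "y \<in> Y"
        note c = pD(2)[OF l y] pD(2)[OF l' y]
        have "cmp Q (tX x) (tY y) q (\<rho> q l y) (f x y) \<sqsubseteq>\<^bsub>Hom Q (tX x) q\<^esub> ?up q (\<rho> q l) x"
          using up_le[OF l' x up_closed[OF l' x], THEN iffD1, OF mono_up[OF l' x]] y by blast
        then show "cmp Q (tX x) (tY y) q (l y) (f x y) \<sqsubseteq>\<^bsub>Hom Q (tX x) q\<^esub> ?up q (\<rho> q l) x"
          using hom_trans[OF cmp_mono_left[OF tX[OF x] tY[OF y] pD(1)[OF l] f[OF x y] c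
              rho_incr[OF l y]] _ tX[OF x] pD(1)[OF l]
              cmp_closed[OF tX[OF x] tY[OF y] pD(1)[OF l] f[OF x y] c(1)]
              cmp_closed[OF tX[OF x] tY[OF y] pD(1)[OF l] f[OF x y] c(2)] up_closed[OF l' x]]
          by blast
      qed
    qed
    show "\<rho> q (\<rho> q l) y = \<rho> q l y" if "y \<in> Y" for y
    proof -
      have app: "\<rho> q k y = \<Sqinter>\<^bsub>Hom Q (tY y) q\<^esub>
          ((\<lambda>x. limp Q (tX x) (tY y) q (?up q k x) (f x y)) ` X)" for k
        using that by (simp add: \<rho>_def)
      show ?thesis unfolding app[of "\<rho> q l"] app[of l] using eq by (simp cong: image_cong_simp)
    qed
  qed
  interpret P: qcategory Q ?P by (rule qcategory_presheaf[OF tYs])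
  have P_elts: "Elts ?K \<subseteq> Elts ?P" "Elts ?P = presheaves Q Y tY" "qtype ?P = fst"
    by (auto simp: kan_fixed_def presheaf_qcat_def)
  interpret K: qcategory Q ?K
  proof
    show "a \<in> Elts ?K \<Longrightarrow> qtype ?K a \<in> Obj Q" for a
      using P.qtype_closed[of a] P_elts K_type by auto
    show "qhom ?K a b \<in> carrier (Hom Q (qtype ?K a) (qtype ?K b))"
      if "a \<in> Elts ?K" "b \<in> Elts ?K" for a b
      using P.qhom_closed[of a b] that P_elts K_type K_hom by auto
    show "idn Q (qtype ?K a) \<sqsubseteq>\<^bsub>Hom Q (qtype ?K a) (qtype ?K a)\<^esub> qhom ?K a a"
      if "a \<in> Elts ?K" for a
      using P.qhom_idn[of a] that P_elts K_type K_hom by auto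
    show "cmp Q (qtype ?K a) (qtype ?K b) (qtype ?K c) (qhom ?K b c) (qhom ?K a b)
        \<sqsubseteq>\<^bsub>Hom Q (qtype ?K a) (qtype ?K c)\<^esub> qhom ?K a c"
      if "a \<in> Elts ?K" "b \<in> Elts ?K" "c \<in> Elts ?K" for a b c
      using P.qhom_cmp[of a b c] that P_elts K_type K_hom by auto
  qed
  show ?thesis
  proof
    fix q :: 'o and m :: "'o \<times> ('y \<Rightarrow> 'a) \<Rightarrow> 'a"
    assume q: "q \<in> Obj Q" and m: "\<And>a. a \<in> Elts ?K \<Longrightarrow> m a \<in> carrier (Hom Q (qtype ?K a) q)"
    have mc: "m a \<in> carrier (Hom Q (fst a) q)" if "a \<in> Elts ?K" for a
      using m[OF that] K_type by simp
    have E: "fst a \<in> Obj Q" "(fst a, snd a) \<in> presheaves Q Y tY" if "a \<in> Elts ?K" for a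
      using that pD(1)[of "fst a" "snd a"] by (auto simp: K_elts)
    define l where "l = (\<lambda>y\<in>Y. \<Squnion>\<^bsub>Hom Q (tY y) q\<^esub>
        ((\<lambda>a. cmp Q (tY y) (fst a) q (m a) (snd a y)) ` Elts ?K))"
    have sub: "(\<lambda>a. cmp Q (tY y) (fst a) q (m a) (snd a y)) ` Elts ?K \<subseteq> carrier (Hom Q (tY y) q)"
      if y: "y \<in> Y" for y
      using q E mc tY[OF y] pD(2)[OF E(2) y] by (auto intro!: cmp_closed)
    have l: "(q, l) \<in> presheaves Q Y tY"
      using q hom_sup_closed[OF tY q sub] by (auto simp: presheaves_def l_def)
    have s: "(q, \<rho> q l) \<in> Elts ?K"
      using rho_closed[OF l] idem[OF l] by (simp add: K_elts)
    show "\<exists>s\<in>Elts ?K. qtype ?K s = q \<and>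
        (\<forall>b\<in>Elts ?K. qhom ?K s b = \<Sqinter>\<^bsub>Hom Q q (qtype ?K b)\<^esub>
          ((\<lambda>a. limp Q (qtype ?K a) q (qtype ?K b) (qhom ?K a b) (m a)) ` Elts ?K))"
    proof (rule bexI[OF _ s], intro conjI ballI)
      show "qtype ?K (q, \<rho> q l) = q" by (simp add: K_type)
      fix b assume b: "b \<in> Elts ?K"
      obtain r k where bk: "b = (r, k)" by (cases b)
      have k: "(r, k) \<in> presheaves Q Y tY" "\<rho> r k = k" using b bk by (auto simp: K_elts)
      note o = q pD(1)[OF k(1)]
      let ?S = "(\<lambda>a. limp Q (fst a) q r (qhom ?P a (r, k)) (m a)) ` Elts ?K"
      have S: "?S \<subseteq> carrier (Hom Q q r)" using o by (auto intro: limp_closed)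
      have hc: "qhom ?P a (r, k) \<in> carrier (Hom Q (fst a) r)" if "a \<in> Elts ?K" for a
        using phom_closed[OF tYs E(2)[OF that] k(1)] by simp
      have "qhom ?P (q, l) (r, k) = \<Sqinter>\<^bsub>Hom Q q r\<^esub> ?S"
      proof (rule hom_eqI[OF o phom_closed[OF tYs l k(1)] hom_inf_closed[OF o S]])
        fix v assume v: "v \<in> carrier (Hom Q q r)"
        have "v \<sqsubseteq>\<^bsub>Hom Q q r\<^esub> \<Sqinter>\<^bsub>Hom Q q r\<^esub> ?S \<longleftrightarrow>
            (\<forall>a\<in>Elts ?K. v \<sqsubseteq>\<^bsub>Hom Q q r\<^esub> limp Q (fst a) q r (qhom ?P a (r, k)) (m a))"
          using le_inf_iff[OF o S v] by simp
        also have "\<dots> \<longleftrightarrow> (\<forall>a\<in>Elts ?K. cmp Q (fst a) q r v (m a) \<sqsubseteq>\<^bsub>Hom Q (fst a) r\<^esub> qhom ?P a (r, k))"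
          using o v hc mc E(1) by (intro ball_cong refl limp_adj) auto
        also have "\<dots> \<longleftrightarrow> (\<forall>a\<in>Elts ?K. \<forall>y\<in>Y.
            cmp Q (tY y) (fst a) r (cmp Q (fst a) q r v (m a)) (snd a y) \<sqsubseteq>\<^bsub>Hom Q (tY y) r\<^esub> k y)"
        proof (intro ball_cong refl)
          fix a assume a: "a \<in> Elts ?K"
          show "cmp Q (fst a) q r v (m a) \<sqsubseteq>\<^bsub>Hom Q (fst a) r\<^esub> qhom ?P a (r, k) \<longleftrightarrow> (\<forall>y\<in>Y.
            cmp Q (tY y) (fst a) r (cmp Q (fst a) q r v (m a)) (snd a y) \<sqsubseteq>\<^bsub>Hom Q (tY y) r\<^esub> k y)"
            using le_phom[OF tYs E(2)[OF a] k(1) cmp_closed[OF E(1)[OF a] o mc[OF a] v]] by simp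
        qed
        also have "\<dots> \<longleftrightarrow> (\<forall>y\<in>Y. \<forall>a\<in>Elts ?K.
            cmp Q (tY y) q r v (cmp Q (tY y) (fst a) q (m a) (snd a y)) \<sqsubseteq>\<^bsub>Hom Q (tY y) r\<^esub> k y)"
        proof -
          have "cmp Q (tY y) (fst a) r (cmp Q (fst a) q r v (m a)) (snd a y) =
              cmp Q (tY y) q r v (cmp Q (tY y) (fst a) q (m a) (snd a y))"
            if "a \<in> Elts ?K" "y \<in> Y" for a y
            using cmp_assoc[OF tY[OF that(2)] E(1)[OF that(1)] o pD(2)[OF E(2)[OF that(1)] that(2)]
                mc[OF that(1)] v] by simp
          then show ?thesis by auto
        qed
        also have "\<dots> \<longleftrightarrow> (\<forall>y\<in>Y. cmp Q (tY y) q r v (l y) \<sqsubseteq>\<^bsub>Hom Q (tY y) r\<^esub> k y)"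
        proof (intro ball_cong refl)
          fix y assume y: "y \<in> Y"
          have "cmp Q (tY y) q r v ` (\<lambda>a. cmp Q (tY y) (fst a) q (m a) (snd a y)) ` Elts ?K
              \<subseteq> carrier (Hom Q (tY y) r)"
            using cmp_closed[OF tY[OF y] o subsetD[OF sub[OF y]] v] by blast
          from sup_le_iff[OF tY[OF y] o(2) this pD(2)[OF k(1) y]]
          show "(\<forall>a\<in>Elts ?K. cmp Q (tY y) q r v (cmp Q (tY y) (fst a) q (m a) (snd a y))
              \<sqsubseteq>\<^bsub>Hom Q (tY y) r\<^esub> k y) \<longleftrightarrow> cmp Q (tY y) q r v (l y) \<sqsubseteq>\<^bsub>Hom Q (tY y) r\<^esub> k y"
            using y by (simp add: l_def cmp_sup_right[OF tY[OF y] o sub[OF y] v])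
        qed
        also have "\<dots> \<longleftrightarrow> v \<sqsubseteq>\<^bsub>Hom Q q r\<^esub> qhom ?P (q, l) (r, k)"
          using le_phom[OF tYs l k(1) v] by simp
        finally show "v \<sqsubseteq>\<^bsub>Hom Q q r\<^esub> qhom ?P (q, l) (r, k) \<longleftrightarrow> v \<sqsubseteq>\<^bsub>Hom Q q r\<^esub> \<Sqinter>\<^bsub>Hom Q q r\<^esub> ?S"
          by simp
      qed
      then show "qhom ?K (q, \<rho> q l) b = \<Sqinter>\<^bsub>Hom Q q (qtype ?K b)\<^esub>
          ((\<lambda>a. limp Q (qtype ?K a) q (qtype ?K b) (qhom ?K a b) (m a)) ` Elts ?K)"
        using refl_hom[OF l k] by (simp add: K_hom K_type bk)
    qed
  qed
qed

end


section \<open>Multi-adjoint property-oriented frames and their concept lattices\<close>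

text \<open>
  The lattices are the types \<open>'l1\<close>, \<open>'l2\<close>, \<open>'p\<close>; \<open>amp i z y\<close> is \<open>z &\<^sub>i y\<close>, \<open>swa i x y\<close> is the residual
  with values in \<open>'p\<close>, and \<open>nwa i x z\<close> the residual with values in \<open>'l2\<close>.
\<close>

locale property_oriented_frame =
  fixes n :: nat
    and amp :: "nat \<Rightarrow> 'p::complete_lattice \<Rightarrow> 'l2::complete_lattice \<Rightarrow> 'l1::complete_lattice"
    and swa :: "nat \<Rightarrow> 'l1 \<Rightarrow> 'l2 \<Rightarrow> 'p"
    and nwa :: "nat \<Rightarrow> 'l1 \<Rightarrow> 'p \<Rightarrow> 'l2"
  assumes amp_swa: "i \<in> {1..n} \<Longrightarrow> amp i z y \<le> x \<longleftrightarrow> z \<le> swa i x y"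
    and amp_nwa: "i \<in> {1..n} \<Longrightarrow> amp i z y \<le> x \<longleftrightarrow> y \<le> nwa i x z"

definition pointwise_le :: "'y set \<Rightarrow> ('y \<Rightarrow> 'l::order) \<Rightarrow> ('y \<Rightarrow> 'l) \<Rightarrow> bool" where
  "pointwise_le Y l l' \<longleftrightarrow> (\<forall>y\<in>Y. l y \<le> l' y)"

definition concept_star ::
    "(nat \<Rightarrow> 'p \<Rightarrow> 'l2 \<Rightarrow> 'l1) \<Rightarrow> 'x set \<Rightarrow> 'y set \<Rightarrow> ('y \<Rightarrow> nat) \<Rightarrow> ('x \<Rightarrow> 'y \<Rightarrow> 'p)
      \<Rightarrow> ('y \<Rightarrow> 'l2) \<Rightarrow> ('x \<Rightarrow> 'l1::complete_lattice)" where
  "concept_star amp X Y t f l = (\<lambda>x\<in>X. SUP y\<in>Y. amp (t y) (f x y) (l y))"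

definition concept_lower ::
    "(nat \<Rightarrow> 'l1 \<Rightarrow> 'p \<Rightarrow> 'l2) \<Rightarrow> 'x set \<Rightarrow> 'y set \<Rightarrow> ('y \<Rightarrow> nat) \<Rightarrow> ('x \<Rightarrow> 'y \<Rightarrow> 'p)
      \<Rightarrow> ('x \<Rightarrow> 'l1) \<Rightarrow> ('y \<Rightarrow> 'l2::complete_lattice)" where
  "concept_lower nwa X Y t f m = (\<lambda>y\<in>Y. INF x\<in>X. nwa (t y) (m x) (f x y))"

definition property_oriented_concept_lattice ::
    "(nat \<Rightarrow> 'p \<Rightarrow> 'l2 \<Rightarrow> 'l1) \<Rightarrow> (nat \<Rightarrow> 'l1 \<Rightarrow> 'p \<Rightarrow> 'l2) \<Rightarrow> 'x set \<Rightarrow> 'y set \<Rightarrow> ('y \<Rightarrow> nat)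
      \<Rightarrow> ('x \<Rightarrow> 'y \<Rightarrow> 'p)
      \<Rightarrow> (('y \<Rightarrow> 'l2::complete_lattice) \<times> ('x \<Rightarrow> 'l1::complete_lattice)) gorder" where
  "property_oriented_concept_lattice amp nwa X Y t f =
     \<lparr>carrier = {(l, m). l \<in> extensional Y \<and> m \<in> extensional X \<and>
                         concept_star amp X Y t f l = m \<and> concept_lower nwa X Y t f m = l},
      eq = (=),
      le = (\<lambda>(l, m) (l', m'). pointwise_le Y l l')\<rparr>"


section \<open>The quantaloid of a multi-adjoint property-oriented frame\<close>

datatype frame_obj = Node nat | Infty

datatype ('l1, 'l2, 'p) frame_arr = BotArr | IdArr | PArr 'p | L2Arr 'l2 | L1Arr 'l1

fun frame_arr_le ::
    "('l1::order, 'l2::order, 'p::order) frame_arr \<Rightarrow> ('l1, 'l2, 'p) frame_arr \<Rightarrow> bool" where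
  "frame_arr_le BotArr BotArr = True"
| "frame_arr_le BotArr IdArr = True"
| "frame_arr_le IdArr IdArr = True"
| "frame_arr_le (PArr u) (PArr u') = (u \<le> u')"
| "frame_arr_le (L2Arr v) (L2Arr v') = (v \<le> v')"
| "frame_arr_le (L1Arr w) (L1Arr w') = (w \<le> w')"
| "frame_arr_le _ _ = False"

text \<open>
  Every hom-set from an object to itself is the two-element chain, including those at \<open>Node 0\<close> and
  \<open>Infty\<close>: a one-element one would make the identity the bottom arrow and hence, composition
  preserving joins, force all hom-sets at that object to be trivial.
\<close>

definition frame_arrs ::
    "frame_obj \<Rightarrow> frame_obj \<Rightarrow> ('l1, 'l2, 'p) frame_arr set" where
  "frame_arrs p q =
     (if p = q then {BotArr, IdArr}
      else if p = Node 0 \<and> q = Infty then range L1Arr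
      else if p = Node 0 then range PArr
      else if q = Infty then range L2Arr
      else {BotArr})"

definition frame_hom ::
    "frame_obj \<Rightarrow> frame_obj \<Rightarrow> ('l1::order, 'l2::order, 'p::order) frame_arr gorder" where
  "frame_hom p q = \<lparr>carrier = frame_arrs p q, eq = (=), le = frame_arr_le\<rparr>"

text \<open>
  \<open>PArr u\<close> and \<open>L2Arr v\<close> are composable only if the object \<open>q\<close> in the middle is an index.
\<close>

definition frame_cmp ::
    "(nat \<Rightarrow> 'p \<Rightarrow> 'l2 \<Rightarrow> 'l1) \<Rightarrow> frame_obj \<Rightarrow> frame_obj \<Rightarrow> frame_obj
      \<Rightarrow> ('l1::order, 'l2::order, 'p::order) frame_arr \<Rightarrow> ('l1, 'l2, 'p) frame_arr
      \<Rightarrow> ('l1, 'l2, 'p) frame_arr" where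
  "frame_cmp amp p q r v u =
     (case (q, u, v) of
        (_, IdArr, _) \<Rightarrow> v
      | (_, _, IdArr) \<Rightarrow> u
      | (Node i, PArr a, L2Arr b) \<Rightarrow> L1Arr (amp i a b)
      | _ \<Rightarrow> \<bottom>\<^bsub>frame_hom p r\<^esub>)"

definition frame_quantaloid ::
    "nat \<Rightarrow> (nat \<Rightarrow> 'p \<Rightarrow> 'l2 \<Rightarrow> 'l1)
      \<Rightarrow> (frame_obj, ('l1::order, 'l2::order, 'p::order) frame_arr) quantaloid" where
  "frame_quantaloid n amp =
     \<lparr>Obj = insert Infty (Node ` {0..n}),
      Hom = frame_hom,
      cmp = frame_cmp amp,
      idn = (\<lambda>_. IdArr)\<rparr>"

subsection \<open>It is a quantaloid\<close>

lemma (in partial_order) sup_eqI: "least L s (Upper L A) \<Longrightarrow> \<Squnion>A = s"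
  unfolding sup_def by (metis least_unique someI)

lemma complete_lattice_of_lub:
  assumes "partial_order L" and "\<And>A. A \<subseteq> carrier L \<Longrightarrow> \<exists>s. least L s (Upper L A)"
  shows "complete_lattice L"
proof -
  interpret partial_order L by fact
  show ?thesis
  proof (rule complete_latticeI)
    fix A assume A: "A \<subseteq> carrier L"
    show "\<exists>s. least L s (Upper L A)" by (rule assms(2)[OF A])
    obtain i where i: "least L i (Upper L (Lower L A))" using assms(2) Lower_closed by metis
    have "greatest L i (Lower L A)"
      using i A by (intro greatest_LowerI)
        (auto simp: least_def Upper_def Lower_def subset_eq)
    then show "\<exists>i. greatest L i (Lower L A)" ..
  qed
qed

lemma sup_image_of_adjoint:
  assumes "complete_lattice L" "complete_lattice M" and A: "A \<subseteq> carrier L"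
    and f: "\<And>a. a \<in> carrier L \<Longrightarrow> f a \<in> carrier M"
    and adj: "\<And>b. b \<in> carrier M \<Longrightarrow> \<exists>g\<in>carrier L. \<forall>a\<in>carrier L. f a \<sqsubseteq>\<^bsub>M\<^esub> b \<longleftrightarrow> a \<sqsubseteq>\<^bsub>L\<^esub> g"
  shows "f (\<Squnion>\<^bsub>L\<^esub> A) = \<Squnion>\<^bsub>M\<^esub> (f ` A)"
proof -
  interpret L: complete_lattice L by fact
  interpret M: complete_lattice M by fact
  have fA: "f ` A \<subseteq> carrier M" using A f by auto
  have *: "f (\<Squnion>\<^bsub>L\<^esub> A) \<sqsubseteq>\<^bsub>M\<^esub> b \<longleftrightarrow> (\<forall>a\<in>A. f a \<sqsubseteq>\<^bsub>M\<^esub> b)" if b: "b \<in> carrier M" for b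
  proof -
    from adj[OF b] obtain g where g: "g \<in> carrier L"
      "\<And>a. a \<in> carrier L \<Longrightarrow> f a \<sqsubseteq>\<^bsub>M\<^esub> b \<longleftrightarrow> a \<sqsubseteq>\<^bsub>L\<^esub> g" by blast
    have "\<Squnion>\<^bsub>L\<^esub> A \<sqsubseteq>\<^bsub>L\<^esub> g \<longleftrightarrow> (\<forall>a\<in>A. a \<sqsubseteq>\<^bsub>L\<^esub> g)"
      using A g(1) by (meson L.le_trans L.sup_closed L.sup_least L.sup_upper subsetD)
    then show ?thesis using g A L.sup_closed[OF A] by (simp add: subset_eq)
  qed
  have "f (\<Squnion>\<^bsub>L\<^esub> A) \<in> carrier M" using A f by simp
  then have "least M (f (\<Squnion>\<^bsub>L\<^esub> A)) (Upper M (f ` A))"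
    using fA * M.le_refl by (intro least_UpperI) (blast, auto simp: Upper_def)
  then show ?thesis using M.sup_eqI by simp
qed

context property_oriented_frame
begin

lemma frame_arr_le_refl: "frame_arr_le a a" by (cases a) auto
lemma frame_arr_le_antisym: "frame_arr_le a b \<Longrightarrow> frame_arr_le b a \<Longrightarrow> a = b"
  by (cases a; cases b) auto
lemma frame_arr_le_trans: "frame_arr_le a b \<Longrightarrow> frame_arr_le b c \<Longrightarrow> frame_arr_le a c"
  by (cases a; cases b; cases c) auto

lemma partial_order_frame_hom: "partial_order (frame_hom p q)"
  by unfold_locales
    (auto simp: frame_hom_def intro: frame_arr_le_refl frame_arr_le_antisym frame_arr_le_trans)

lemma frame_hom_simps [simp]:
  "carrier (frame_hom p q) = frame_arrs p q" "le (frame_hom p q) = frame_arr_le"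
  by (simp_all add: frame_hom_def)

lemma least_frame_hom_range:
  fixes c :: "'z::complete_lattice \<Rightarrow> ('l1, 'l2, 'p) frame_arr"
  assumes "frame_arrs p q = range c" "\<And>a b. frame_arr_le (c a) (c b) \<longleftrightarrow> a \<le> b" "A \<subseteq> range c"
  shows "least (frame_hom p q) (c (Sup (c -` A))) (Upper (frame_hom p q) A)"
proof (rule least_UpperI)
  fix x assume "x \<in> A"
  then show "x \<sqsubseteq>\<^bsub>frame_hom p q\<^esub> c (Sup (c -` A))"
    using assms(2,3) by (auto intro!: Sup_upper vimageI2)
next
  fix x assume x: "x \<in> Upper (frame_hom p q) A"
  then obtain z where z: "x = c z" using assms(1) by (auto simp: Upper_def)
  have "a \<le> z" if "c a \<in> A" for a
    using x that assms unfolding z by (auto simp: Upper_def)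
  then show "c (Sup (c -` A)) \<sqsubseteq>\<^bsub>frame_hom p q\<^esub> x"
    using assms by (auto simp: z intro: Sup_least)
qed (use assms in auto)

lemma complete_lattice_frame_hom:
  "complete_lattice (frame_hom p q :: ('l1, 'l2, 'p) frame_arr gorder)"
proof (rule complete_lattice_of_lub[OF partial_order_frame_hom])
  fix A :: "('l1, 'l2, 'p) frame_arr set" assume "A \<subseteq> carrier (frame_hom p q)"
  then have A: "A \<subseteq> frame_arrs p q" by simp
  let ?H = "frame_hom p q :: ('l1, 'l2, 'p) frame_arr gorder"
  consider "p = q" | "p = Node 0" "q = Infty" | "p = Node 0" "q \<noteq> Infty" "p \<noteq> q"
    | "p \<noteq> Node 0" "q = Infty" "p \<noteq> q" | "p \<noteq> Node 0" "q \<noteq> Infty" "p \<noteq> q" by blast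
  then show "\<exists>s. least ?H s (Upper ?H A)"
  proof cases
    case 1
    then have "least ?H (if IdArr \<in> A then IdArr else BotArr) (Upper ?H A)"
      using A by (auto simp: least_def Upper_def frame_arrs_def subset_eq)
    then show ?thesis ..
  next
    case 2
    then show ?thesis using A least_frame_hom_range[of p q L1Arr A] by (auto simp: frame_arrs_def)
  next
    case 3
    then show ?thesis using A least_frame_hom_range[of p q PArr A] by (auto simp: frame_arrs_def)
  next
    case 4
    then show ?thesis using A least_frame_hom_range[of p q L2Arr A] by (auto simp: frame_arrs_def)
  next
    case 5
    then have "least ?H BotArr (Upper ?H A)"
      using A by (auto simp: least_def Upper_def frame_arrs_def subset_eq)
    then show ?thesis ..
  qed
qed

lemma bottom_frame_hom:
  "(\<bottom>\<^bsub>frame_hom p q\<^esub> :: ('l1, 'l2, 'p) frame_arr) =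
     (if p = q then BotArr
      else if p = Node 0 \<and> q = Infty then L1Arr bot
      else if p = Node 0 then PArr bot
      else if q = Infty then L2Arr bot
      else BotArr)" (is "_ = ?b")
proof -
  interpret complete_lattice "frame_hom p q :: ('l1, 'l2, 'p) frame_arr gorder"
    by (rule complete_lattice_frame_hom)
  have "least (frame_hom p q) ?b (carrier (frame_hom p q))"
    by (auto simp: least_def frame_arrs_def)
  then show ?thesis using bottom_least least_unique by blast
qed

lemma top_frame_hom:
  "\<exists>g \<in> frame_arrs p q. \<forall>a \<in> frame_arrs p q. frame_arr_le a (g :: ('l1, 'l2, 'p) frame_arr)"
proof -
  interpret complete_lattice "frame_hom p q :: ('l1, 'l2, 'p) frame_arr gorder"
    by (rule complete_lattice_frame_hom)
  show ?thesis using top_closed top_higher by (metis frame_hom_simps)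
qed

lemma amp_bot [simp]: "i \<in> {1..n} \<Longrightarrow> amp i bot y = bot" "i \<in> {1..n} \<Longrightarrow> amp i z bot = bot"
  by (metis amp_swa bot_least bot_unique, metis amp_nwa bot_least bot_unique)


lemma frame_cmp_id: "frame_cmp amp p q r v IdArr = v" "frame_cmp amp p q r IdArr u = u"
  by (auto simp: frame_cmp_def split: frame_obj.split frame_arr.split)

lemma frame_cmp_other:
  "\<lbrakk>u \<noteq> IdArr; v \<noteq> IdArr; \<nexists>i a b. q = Node i \<and> u = PArr a \<and> v = L2Arr b\<rbrakk>
    \<Longrightarrow> frame_cmp amp p q r v u = \<bottom>\<^bsub>frame_hom p r\<^esub>"
  by (auto simp: frame_cmp_def split: frame_obj.split frame_arr.split)

lemma frame_cmp_main: "frame_cmp amp p (Node i) r (L2Arr b) (PArr a) = L1Arr (amp i a b)"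
  by (simp add: frame_cmp_def)

lemma frame_arrs_cases:
  assumes "u \<in> frame_arrs p q"
  obtains "u = IdArr" "p = q" | a where "u = PArr a" "p = Node 0" "q \<noteq> Infty" "q \<noteq> Node 0"
    | b where "u = L2Arr b" "p \<noteq> Infty" "p \<noteq> Node 0" "q = Infty"
    | w where "u = L1Arr w" "p = Node 0" "q = Infty"
    | "u = BotArr" "p = q \<or> p = Infty \<or> p \<noteq> Node 0 \<and> q \<noteq> Infty"
  using assms by (auto simp: frame_arrs_def split: if_splits)

lemma bottom_frame_arrs: "(\<bottom>\<^bsub>frame_hom p q\<^esub> :: ('l1, 'l2, 'p) frame_arr) \<in> frame_arrs p q"
  by (simp add: bottom_frame_hom frame_arrs_def)

abbreviation "frame_objs \<equiv> insert Infty (Node ` {0..n})"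

lemma frame_cmp_bot:
  assumes "p \<in> frame_objs" "q \<in> frame_objs" "r \<in> frame_objs"
    "u \<in> frame_arrs p q" "v \<in> frame_arrs q r"
    and bot: "u = \<bottom>\<^bsub>frame_hom p q\<^esub> \<or> v = \<bottom>\<^bsub>frame_hom q r\<^esub>"
  shows "frame_cmp amp p q r v u = \<bottom>\<^bsub>frame_hom p r\<^esub>"
proof -
  consider "u = IdArr" "p = q" | "v = IdArr" "q = r" | "u \<noteq> IdArr" "v \<noteq> IdArr"
    using assms(4,5) by (auto elim: frame_arrs_cases)
  then show ?thesis
  proof cases
    case 1
    then show ?thesis using bot by (auto simp: frame_cmp_id bottom_frame_hom)
  next
    case 2
    then show ?thesis using bot by (auto simp: frame_cmp_id bottom_frame_hom)
  next
    case 3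
    show ?thesis
    proof (cases "\<exists>i a b. q = Node i \<and> u = PArr a \<and> v = L2Arr b")
      case True
      then obtain i a b where e: "q = Node i" "u = PArr a" "v = L2Arr b" by blast
      have p: "p = Node 0" "i \<noteq> 0" using assms(4) e by (auto elim: frame_arrs_cases)
      have r: "r = Infty" using assms(5) e by (auto elim: frame_arrs_cases)
      have i: "i \<in> {1..n}" using assms(2) p e by auto
      have "a = bot \<or> b = bot" using bot p r e by (auto simp: bottom_frame_hom)
      then have "amp i a b = bot" using i amp_bot by blast
      then show ?thesis by (simp add: e p r frame_cmp_main bottom_frame_hom)
    next
      case False
      then show ?thesis using frame_cmp_other[OF 3] by blast
    qed
  qed
qed

lemma frame_cmp_closed:
  assumes "p \<in> frame_objs" "q \<in> frame_objs" "r \<in> frame_objs"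
    "u \<in> frame_arrs p q" "v \<in> frame_arrs q r"
  shows "frame_cmp amp p q r v u \<in> frame_arrs p r"
proof (cases "u = IdArr \<or> v = IdArr")
  case True
  then show ?thesis using assms(4,5) by (auto simp: frame_cmp_id elim: frame_arrs_cases)
next
  case False
  show ?thesis
  proof (cases "\<exists>i a b. q = Node i \<and> u = PArr a \<and> v = L2Arr b")
    case True
    then obtain i a b where e: "q = Node i" "u = PArr a" "v = L2Arr b" by blast
    have "p = Node 0" using assms(4) e by (auto elim: frame_arrs_cases)
    moreover have "r = Infty" using assms(5) e by (auto elim: frame_arrs_cases)
    ultimately show ?thesis by (simp add: e frame_cmp_main frame_arrs_def)
  next
    case nex: False
    with False show ?thesis
      using frame_cmp_other[of u v q p r] bottom_frame_arrs by simp
  qed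
qed

lemma frame_cmp_assoc:
  assumes "p \<in> frame_objs" "q \<in> frame_objs" "r \<in> frame_objs" "s \<in> frame_objs"
    "u \<in> frame_arrs p q" "v \<in> frame_arrs q r" "w \<in> frame_arrs r s"
  shows "frame_cmp amp p r s w (frame_cmp amp p q r v u) =
         frame_cmp amp p q s (frame_cmp amp q r s w v) u"
proof -
  consider "u = IdArr" | "v = IdArr" | "w = IdArr" | "u \<noteq> IdArr" "v \<noteq> IdArr" "w \<noteq> IdArr" by blast
  then show ?thesis
  proof cases
    case 4
    have "\<not> (\<exists>i a b. q = Node i \<and> u = PArr a \<and> v = L2Arr b) \<or>
          w = \<bottom>\<^bsub>frame_hom r s\<^esub>"
      using assms(6,7) 4 by (auto simp: frame_arrs_def bottom_frame_hom split: if_splits)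
    then have "frame_cmp amp p q r v u = \<bottom>\<^bsub>frame_hom p r\<^esub> \<or> w = \<bottom>\<^bsub>frame_hom r s\<^esub>"
      using frame_cmp_other[OF 4(1,2)] by blast
    then have l: "frame_cmp amp p r s w (frame_cmp amp p q r v u) = \<bottom>\<^bsub>frame_hom p s\<^esub>"
      using assms by (intro frame_cmp_bot frame_cmp_closed)
    have "\<not> (\<exists>i a b. r = Node i \<and> v = PArr a \<and> w = L2Arr b) \<or>
          u = \<bottom>\<^bsub>frame_hom p q\<^esub>"
      using assms(5,6) 4 by (auto simp: frame_arrs_def bottom_frame_hom split: if_splits)
    then have "u = \<bottom>\<^bsub>frame_hom p q\<^esub> \<or> frame_cmp amp q r s w v = \<bottom>\<^bsub>frame_hom q s\<^esub>"
      using frame_cmp_other[OF 4(2,3)] by blast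
    then have "frame_cmp amp p q s (frame_cmp amp q r s w v) u = \<bottom>\<^bsub>frame_hom p s\<^esub>"
      using assms by (intro frame_cmp_bot frame_cmp_closed)
    with l show ?thesis by simp
  qed (use assms(5-7) in \<open>auto simp: frame_cmp_id elim: frame_arrs_cases\<close>)
qed

lemma bottom_le: "a \<in> frame_arrs p q \<Longrightarrow> frame_arr_le (\<bottom>\<^bsub>frame_hom p q\<^esub>) (a :: ('l1, 'l2, 'p) frame_arr)"
  by (auto simp: frame_arrs_def bottom_frame_hom split: if_splits)

lemma BotArr_bottom: "BotArr \<in> frame_arrs p q \<Longrightarrow> BotArr = (\<bottom>\<^bsub>frame_hom p q\<^esub> :: ('l1, 'l2, 'p) frame_arr)"
  by (auto simp: frame_arrs_def bottom_frame_hom split: if_splits)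

lemma frame_cmp_adj_right:
  assumes O: "p \<in> frame_objs" "q \<in> frame_objs" "r \<in> frame_objs"
    and v: "v \<in> frame_arrs q r" and w: "w \<in> frame_arrs p r"
  shows "\<exists>g\<in>frame_arrs p q. \<forall>u\<in>frame_arrs p q.
           frame_arr_le (frame_cmp amp p q r v u) w \<longleftrightarrow> frame_arr_le u g"
proof -
  obtain t where t: "t \<in> frame_arrs p q"
      "\<And>u :: ('l1, 'l2, 'p) frame_arr. u \<in> frame_arrs p q \<Longrightarrow> frame_arr_le u t"
    using top_frame_hom by blast
  consider "v = IdArr" | i b where "v = L2Arr b" "q = Node i" "p = Node 0" "i \<noteq> 0"
    | "p = q" "v \<noteq> IdArr" | "v \<noteq> IdArr" "p \<noteq> q" "\<not> (\<exists>b i. v = L2Arr b \<and> q = Node i \<and> p = Node 0)"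
    using v by (cases q) (auto simp: frame_arrs_def split: if_splits)
  then show ?thesis
  proof cases
    case 1
    then have "q = r" using v by (auto elim: frame_arrs_cases)
    then show ?thesis using w 1 by (auto simp: frame_cmp_id)
  next
    case 2
    then have "r = Infty" using v by (auto elim: frame_arrs_cases)
    with 2 w obtain c where c: "w = L1Arr c" by (auto simp: frame_arrs_def)
    have "i \<in> {1..n}" using O 2 by auto
    then show ?thesis using 2 c
      by (intro bexI[of _ "PArr (swa i c b)"]) (auto simp: frame_arrs_def frame_cmp_main amp_swa)
  next
    case 3
    then have *: "frame_cmp amp p q r v BotArr = \<bottom>\<^bsub>frame_hom p r\<^esub>"
      using O v by (intro frame_cmp_bot) (auto simp: frame_arrs_def bottom_frame_hom)
    show ?thesis
    proof (cases "frame_arr_le v w")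
      case True
      with 3 * w show ?thesis
        by (intro bexI[of _ IdArr]) (auto simp: frame_cmp_id frame_arrs_def[of q q] bottom_le)
    next
      case False
      with 3 * w show ?thesis
        by (intro bexI[of _ BotArr]) (auto simp: frame_cmp_id frame_arrs_def[of q q] bottom_le)
    qed
  next
    case 4
    have "frame_cmp amp p q r v u = \<bottom>\<^bsub>frame_hom p r\<^esub>" if "u \<in> frame_arrs p q" for u
    proof -
      have "u \<noteq> IdArr" using that 4 by (auto simp: frame_arrs_def split: if_splits)
      moreover have "\<not> (\<exists>i a b. q = Node i \<and> u = PArr a \<and> v = L2Arr b)"
        using 4 that by (auto simp: frame_arrs_def split: if_splits)
      ultimately show ?thesis using 4(1) frame_cmp_other by blast
    qed
    then show ?thesis using t w bottom_le by (intro bexI[of _ t]) auto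
  qed
qed

lemma frame_cmp_adj_left:
  assumes O: "p \<in> frame_objs" "q \<in> frame_objs" "r \<in> frame_objs"
    and u: "u \<in> frame_arrs p q" and w: "w \<in> frame_arrs p r"
  shows "\<exists>g\<in>frame_arrs q r. \<forall>v\<in>frame_arrs q r.
           frame_arr_le (frame_cmp amp p q r v u) w \<longleftrightarrow> frame_arr_le v g"
proof -
  obtain t where t: "t \<in> frame_arrs q r"
      "\<And>u :: ('l1, 'l2, 'p) frame_arr. u \<in> frame_arrs q r \<Longrightarrow> frame_arr_le u t"
    using top_frame_hom by blast
  consider "u = IdArr" | i a where "u = PArr a" "q = Node i" "p = Node 0" "r = Infty" "i \<noteq> 0"
    | "q = r" "u \<noteq> IdArr" | "u \<noteq> IdArr" "q \<noteq> r" "\<not> (\<exists>a i. u = PArr a \<and> q = Node i \<and> r = Infty)"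
    using u by (cases q) (auto simp: frame_arrs_def split: if_splits)
  then show ?thesis
  proof cases
    case 1
    then have "p = q" using u by (auto elim: frame_arrs_cases)
    then show ?thesis using w 1 by (auto simp: frame_cmp_id)
  next
    case 2
    with w obtain c where c: "w = L1Arr c" by (auto simp: frame_arrs_def)
    have "i \<in> {1..n}" using O 2 by auto
    then show ?thesis using 2 c
      by (intro bexI[of _ "L2Arr (nwa i c a)"]) (auto simp: frame_arrs_def frame_cmp_main amp_nwa)
  next
    case 3
    then have *: "frame_cmp amp p q r BotArr u = \<bottom>\<^bsub>frame_hom p r\<^esub>"
      using O u by (intro frame_cmp_bot) (auto simp: frame_arrs_def bottom_frame_hom)
    show ?thesis
    proof (cases "frame_arr_le u w")
      case True
      with 3 * w show ?thesis
        by (intro bexI[of _ IdArr]) (auto simp: frame_cmp_id frame_arrs_def[of r r] bottom_le)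
    next
      case False
      with 3 * w show ?thesis
        by (intro bexI[of _ BotArr]) (auto simp: frame_cmp_id frame_arrs_def[of r r] bottom_le)
    qed
  next
    case 4
    have "frame_cmp amp p q r v u = \<bottom>\<^bsub>frame_hom p r\<^esub>" if "v \<in> frame_arrs q r" for v
    proof -
      have "v \<noteq> IdArr" using that 4 by (auto simp: frame_arrs_def split: if_splits)
      moreover have "\<not> (\<exists>i a b. q = Node i \<and> u = PArr a \<and> v = L2Arr b)"
        using 4 that by (auto simp: frame_arrs_def split: if_splits)
      ultimately show ?thesis using 4(1) frame_cmp_other by blast
    qed
    then show ?thesis using t w bottom_le by (intro bexI[of _ t]) auto
  qed
qed

theorem quantaloid_frame_quantaloid: "quantaloid (frame_quantaloid n amp)"
proof (rule quantaloid.intro, unfold frame_quantaloid_def quantaloid.select_convs)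
  fix p q r and A :: "('l1, 'l2, 'p) frame_arr set" and v :: "('l1, 'l2, 'p) frame_arr"
  assume a: "p \<in> frame_objs" "q \<in> frame_objs" "r \<in> frame_objs"
    "A \<subseteq> carrier (frame_hom p q)" "v \<in> carrier (frame_hom q r)"
  show "frame_cmp amp p q r v (\<Squnion>\<^bsub>frame_hom p q\<^esub> A) =
      \<Squnion>\<^bsub>frame_hom p r\<^esub> (frame_cmp amp p q r v ` A)"
    by (rule sup_image_of_adjoint[OF complete_lattice_frame_hom complete_lattice_frame_hom a(4)])
      (use frame_cmp_closed[OF a(1-3)] frame_cmp_adj_right[OF a(1-3)] a(5) in simp_all)
next
  fix p q r and B :: "('l1, 'l2, 'p) frame_arr set" and u :: "('l1, 'l2, 'p) frame_arr"
  assume a: "p \<in> frame_objs" "q \<in> frame_objs" "r \<in> frame_objs"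
    "u \<in> carrier (frame_hom p q)" "B \<subseteq> carrier (frame_hom q r)"
  show "frame_cmp amp p q r (\<Squnion>\<^bsub>frame_hom q r\<^esub> B) u =
      \<Squnion>\<^bsub>frame_hom p r\<^esub> ((\<lambda>v. frame_cmp amp p q r v u) ` B)"
    by (rule sup_image_of_adjoint[OF complete_lattice_frame_hom complete_lattice_frame_hom a(5)])
      (use frame_cmp_closed[OF a(1-3)] frame_cmp_adj_left[OF a(1-3)] a(4) in simp_all)
qed (simp_all add: frame_cmp_id frame_cmp_closed frame_cmp_assoc complete_lattice_frame_hom,
     simp add: frame_arrs_def)

lemma qrelation_frame_relation:
  assumes "t \<in> Y \<rightarrow> {1..n}"
  shows "qrelation (frame_quantaloid n amp) X (\<lambda>_. Node 0) Y (\<lambda>y. Node (t y))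
           (\<lambda>x y. PArr (f x y))"
  using assms by (auto simp: qrelation_def frame_quantaloid_def frame_arrs_def Pi_iff)

end

end

theory Submission
  imports Defs
begin

text \<open>
  At \<open>Infty\<close>, composition with \<open>PArr z\<close> is \<open>z &\<^sub>i _\<close> and its right adjoint is the residual \<open>nwa\<close>,
  so under \<open>L2Arr\<close> and \<open>L1Arr\<close> the Kan adjunction restricted to presheaves of type \<open>Infty\<close> is the
  Galois connection defining the concept lattice.  Hence \<open>(l, m) \<mapsto> (Infty, L2Arr \<circ> l)\<close> is an order
  isomorphism onto the fibre, and it preserves all suprema and infima because the concept
  lattice is complete.
\<close>

section \<open>Transport of bounds and completeness along order isomorphisms\<close>

lemma (in partial_order) inf_eqI: "greatest L i (Lower L A) \<Longrightarrow> \<Sqinter>A = i"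
  unfolding inf_def by (metis greatest_unique someI)

lemma least_order_iso:
  assumes bij: "bij_betw f (carrier L) (carrier M)"
    and le: "\<And>a b. \<lbrakk>a \<in> carrier L; b \<in> carrier L\<rbrakk> \<Longrightarrow> a \<sqsubseteq>\<^bsub>L\<^esub> b \<longleftrightarrow> f a \<sqsubseteq>\<^bsub>M\<^esub> f b"
    and A: "A \<subseteq> carrier L" and s: "least L s (Upper L A)"
  shows "least M (f s) (Upper M (f ` A))"
proof -
  have im: "carrier M = f ` carrier L" using bij by (simp add: bij_betw_def)
  have "Upper M (f ` A) = f ` Upper L A"
    using A le unfolding Upper_def im by (auto simp: subset_eq)
  then show ?thesis
    using s le A unfolding least_def by (auto simp: im Upper_def)
qed

lemma greatest_order_iso:
  assumes "bij_betw f (carrier L) (carrier M)"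
    and "\<And>a b. \<lbrakk>a \<in> carrier L; b \<in> carrier L\<rbrakk> \<Longrightarrow> a \<sqsubseteq>\<^bsub>L\<^esub> b \<longleftrightarrow> f a \<sqsubseteq>\<^bsub>M\<^esub> f b"
    and "A \<subseteq> carrier L" "greatest L i (Lower L A)"
  shows "greatest M (f i) (Lower M (f ` A))"
  using least_order_iso[of f "inv_gorder L" "inv_gorder M" A i] assms by simp

text \<open>Only \<open>L\<close> is known to be complete: the order axioms of \<open>M\<close> are
  pulled back along \<open>f\<close>, and its bounds are images of bounds in \<open>L\<close>.
  Antisymmetry in \<open>M\<close> then identifies these images with the chosen suprema and
  infima.\<close>

lemma complete_lattice_iso_of_order_iso:
  assumes "complete_lattice L" and eq: "eq M = (=)"
    and bij: "bij_betw f (carrier L) (carrier M)"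
    and le: "\<And>a b. \<lbrakk>a \<in> carrier L; b \<in> carrier L\<rbrakk> \<Longrightarrow> a \<sqsubseteq>\<^bsub>L\<^esub> b \<longleftrightarrow> f a \<sqsubseteq>\<^bsub>M\<^esub> f b"
  shows "complete_lattice_iso L M f"
proof -
  interpret L: complete_lattice L by fact
  have im: "carrier M = f ` carrier L" using bij by (simp add: bij_betw_def)
  interpret M: partial_order M
    by unfold_locales
      (auto simp: eq im le[symmetric] intro: L.le_trans dest: L.le_antisym)
  have sup: "least M (f (\<Squnion>\<^bsub>L\<^esub>A)) (Upper M (f ` A))" if "A \<subseteq> carrier L" for A
    using least_order_iso[OF bij le that L.sup_lub[OF that]] by simp
  have inf: "greatest M (f (\<Sqinter>\<^bsub>L\<^esub>A)) (Lower M (f ` A))" if "A \<subseteq> carrier L" for A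
    using greatest_order_iso[OF bij le that L.inf_glb[OF that]] by simp
  have "complete_lattice M"
    by (rule complete_lattice_of_lub[OF M.partial_order_axioms])
      (metis im sup subset_imageE)
  then show ?thesis
    using assms M.sup_eqI[OF sup] M.inf_eqI[OF inf]
    by (simp add: complete_lattice_iso_def sup_pres_def inf_pres_def)
qed

lemma pointwise_le_refl: "pointwise_le Z a a"
  by (simp add: pointwise_le_def)

lemma pointwise_le_trans: "pointwise_le Z a b \<Longrightarrow> pointwise_le Z b c \<Longrightarrow> pointwise_le Z a c"
  unfolding pointwise_le_def by (meson order_trans)

lemma pointwise_le_antisym:
  "\<lbrakk>pointwise_le Z a b; pointwise_le Z b a; a \<in> extensional Z; b \<in> extensional Z\<rbrakk> \<Longrightarrow> a = b"
  by (rule extensionalityI[of _ Z]) (auto simp: pointwise_le_def intro: antisym)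

section \<open>Joins, meets and left implication in the hom-sets of the quantaloid\<close>

context property_oriented_frame
begin

abbreviation "\<Q> \<equiv> frame_quantaloid n amp"

lemma frame_quantaloid_simps [simp]:
  "Obj \<Q> = frame_objs" "Hom \<Q> = frame_hom" "cmp \<Q> = frame_cmp amp" "idn \<Q> = (\<lambda>_. IdArr)"
  by (simp_all add: frame_quantaloid_def)

lemma sup_frame_hom_range:
  fixes c :: "'z::complete_lattice \<Rightarrow> ('l1, 'l2, 'p) frame_arr"
  assumes "frame_arrs p q = range c" "\<And>a b. frame_arr_le (c a) (c b) \<longleftrightarrow> a \<le> b"
  shows "\<Squnion>\<^bsub>frame_hom p q\<^esub> (c ` S) = c (Sup S)"
proof -
  have "inj c" by (rule injI, rule antisym) (simp_all add: assms(2)[symmetric] frame_arr_le_refl)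
  then show ?thesis
    using partial_order.sup_eqI[OF partial_order_frame_hom least_frame_hom_range[OF assms, of "c ` S"]]
    by (simp add: inj_vimage_image_eq image_subset_iff)
qed

lemma inf_frame_hom_range:
  fixes c :: "'z::complete_lattice \<Rightarrow> ('l1, 'l2, 'p) frame_arr"
  assumes "frame_arrs p q = range c" "\<And>a b. frame_arr_le (c a) (c b) \<longleftrightarrow> a \<le> b"
  shows "\<Sqinter>\<^bsub>frame_hom p q\<^esub> (c ` S) = c (Inf S)"
proof (rule partial_order.inf_eqI[OF partial_order_frame_hom], rule greatest_LowerI)
  fix b assume b: "b \<in> Lower (frame_hom p q) (c ` S)"
  then obtain z where "b = c z" using assms(1) by (auto simp: Lower_def)
  with b show "b \<sqsubseteq>\<^bsub>frame_hom p q\<^esub> c (Inf S)"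
    using assms by (fastforce simp: Lower_def le_Inf_iff)
qed (auto simp: assms Inf_lower)

text \<open>By residuation, the arrows whose join defines the implication form a copy of the
  principal down-set of \<open>nwa i w a\<close>, whose supremum is its top element.\<close>

lemma limp_frame:
  assumes "i \<in> {1..n}"
  shows "limp \<Q> (Node 0) (Node i) Infty (L1Arr w) (PArr a) = L2Arr (nwa i w a)"
proof -
  \<comment> \<open>Here \<open>i \<noteq> 0\<close> matters: the hom-set from \<open>Node 0\<close>
    to \<open>Infty\<close> is a copy of \<open>'l1\<close> instead.\<close>
  have r: "frame_arrs (Node i) Infty = range L2Arr" using assms by (auto simp: frame_arrs_def)
  have "{v \<in> carrier (frame_hom (Node i) Infty).
      frame_cmp amp (Node 0) (Node i) Infty v (PArr a) \<sqsubseteq>\<^bsub>frame_hom (Node 0) Infty\<^esub> L1Arr w} =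
    L2Arr ` {..nwa i w a}"
    using assms by (auto simp: r frame_cmp_main amp_nwa)
  then show ?thesis
    by (simp add: limp_def sup_frame_hom_range[OF r])
qed

context
  fixes X :: "'x set" and Y :: "'y set" and t :: "'y \<Rightarrow> nat" and \<phi> :: "'x \<Rightarrow> 'y \<Rightarrow> 'p"
  assumes t: "t \<in> Y \<rightarrow> {1..n}"
begin

section \<open>The Galois connection and completeness of the concept lattice\<close>

abbreviation "up \<equiv> concept_star amp X Y t \<phi>"
abbreviation "down \<equiv> concept_lower nwa X Y t \<phi>"

lemma concept_galois: "pointwise_le X (up l) m \<longleftrightarrow> pointwise_le Y l (down m)"
proof -
  have "amp (t y) (\<phi> x y) (l y) \<le> m x \<longleftrightarrow> l y \<le> nwa (t y) (m x) (\<phi> x y)" if "y \<in> Y" for x y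
    using amp_nwa that t by blast
  then show ?thesis
    by (auto simp: pointwise_le_def concept_star_def concept_lower_def SUP_le_iff le_INF_iff)
qed

lemma concept_unit: "pointwise_le Y l (down (up l))"
  by (rule concept_galois[THEN iffD1]) (rule pointwise_le_refl)

lemma concept_counit: "pointwise_le X (up (down m)) m"
  by (rule concept_galois[THEN iffD2]) (rule pointwise_le_refl)

lemma concept_extensional: "up l \<in> extensional X" "down m \<in> extensional Y"
  by (simp_all add: concept_star_def concept_lower_def)

lemma concept_star_idem: "up (down (up l)) = up l"
proof (rule pointwise_le_antisym[OF concept_counit _ concept_extensional(1) concept_extensional(1)])
  \<comment> \<open>Transposed along the Galois connection, this becomes two successive applications
    of the unit.\<close>
  show "pointwise_le X (up l) (up (down (up l)))"
    unfolding concept_galois by (rule pointwise_le_trans[OF concept_unit concept_unit])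
qed

abbreviation "concepts \<equiv> property_oriented_concept_lattice amp nwa X Y t \<phi>"

lemma carrier_concepts:
  "carrier concepts = {(l, up l) | l. l \<in> extensional Y \<and> down (up l) = l}"
  by (auto simp: property_oriented_concept_lattice_def concept_extensional)

lemma le_concepts: "a \<sqsubseteq>\<^bsub>concepts\<^esub> b \<longleftrightarrow> pointwise_le Y (fst a) (fst b)"
  by (simp add: property_oriented_concept_lattice_def case_prod_unfold)

lemma eq_concepts: "(.=\<^bsub>concepts\<^esub>) = (=)"
  by (simp add: property_oriented_concept_lattice_def)

text \<open>The supremum of a family of concepts is the closure of the pointwise supremum of their
  first components; closing makes it both a fixed point and extensional.\<close>

lemma complete_lattice_concepts: "complete_lattice concepts"
proof (rule complete_lattice_of_lub)
  show "partial_order concepts"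
  proof
    show "(.=\<^bsub>concepts\<^esub>) = (=)" by (rule eq_concepts)
  qed (auto simp: eq_concepts carrier_concepts le_concepts pointwise_le_refl
        intro: pointwise_le_trans dest: pointwise_le_antisym)
next
  fix A assume A: "A \<subseteq> carrier concepts"
  define s where "s = down (up (\<lambda>y. SUP a\<in>A. fst a y))"
  have s: "(s, up s) \<in> carrier concepts"
    by (auto simp: carrier_concepts s_def concept_extensional concept_star_idem)
  have "least concepts (s, up s) (Upper concepts A)"
  proof (rule least_UpperI[OF _ _ A s])
    fix a assume a: "a \<in> A"
    have "pointwise_le Y (fst a) (\<lambda>y. SUP a\<in>A. fst a y)"
      using a by (auto simp: pointwise_le_def intro: SUP_upper2)
    then show "a \<sqsubseteq>\<^bsub>concepts\<^esub> (s, up s)"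
      by (simp add: le_concepts s_def pointwise_le_trans[OF _ concept_unit])
  next
    fix b assume b: "b \<in> Upper concepts A"
    then have "b \<in> carrier concepts" by (auto simp: Upper_def)
    then obtain l where l: "b = (l, up l)" "down (up l) = l" by (auto simp: carrier_concepts)
    have "pointwise_le Y (fst a) l" if "a \<in> A" for a
      using Upper_memD[OF b that A] by (simp add: le_concepts l(1))
    then have "pointwise_le Y (\<lambda>y. SUP a\<in>A. fst a y) l"
      by (auto simp: pointwise_le_def intro: SUP_least)
    \<comment> \<open>Since \<open>l\<close> is a fixed point, lying below \<open>l\<close> means
      lying below \<open>down (up l)\<close>, so the closure \<open>s\<close> stays below
      \<open>l\<close> by transposing twice.\<close>
    then have "pointwise_le X (up (\<lambda>y. SUP a\<in>A. fst a y)) (up l)"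
      by (simp add: concept_galois l(2))
    then have "pointwise_le Y s (down (up l))"
      unfolding s_def concept_galois[symmetric] by (rule pointwise_le_trans[OF concept_counit])
    then show "(s, up s) \<sqsubseteq>\<^bsub>concepts\<^esub> b" by (simp add: le_concepts l)
  qed
  then show "\<exists>s. least concepts s (Upper concepts A)" ..
qed

section \<open>The Kan adjunction at type \<open>Infty\<close> and the fibre of its fixed
  points\<close>

abbreviation "kan_up \<equiv> kan_star \<Q> X (\<lambda>_. Node 0) Y (\<lambda>y. Node (t y)) (\<lambda>x y. PArr (\<phi> x y))"
abbreviation "kan_down \<equiv> kan_lower \<Q> X (\<lambda>_. Node 0) Y (\<lambda>y. Node (t y)) (\<lambda>x y. PArr (\<phi> x y))"
abbreviation "kan_fib \<equiv> fibre \<Q> (kan_fixed \<Q> X (\<lambda>_. Node 0) Y (\<lambda>y. Node (t y))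
  (\<lambda>x y. PArr (\<phi> x y))) Infty"

text \<open>The restriction to \<open>Y\<close> keeps the presheaf extensional: outside
  \<open>Y\<close> the value of \<open>L2Arr \<circ> l\<close> need not be the
  \<open>undefined\<close> of the arrow type.\<close>

abbreviation of_concept :: "('y \<Rightarrow> 'l2) \<Rightarrow> frame_obj \<times> ('y \<Rightarrow> ('l1, 'l2, 'p) frame_arr)" where
  "of_concept l \<equiv> (Infty, \<lambda>y\<in>Y. L2Arr (l y))"

lemma index: "y \<in> Y \<Longrightarrow> t y \<in> {1..n}"
  using t by blast

lemma kan_star_of_concept: "kan_up (of_concept l) = (Infty, \<lambda>x\<in>X. L1Arr (up l x))"
proof -
  have r: "frame_arrs (Node 0) Infty = range L1Arr" by (simp add: frame_arrs_def)
  have "(\<lambda>y. frame_cmp amp (Node 0) (Node (t y)) Infty ((\<lambda>y\<in>Y. L2Arr (l y)) y) (PArr (\<phi> x y))) ` Y =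
      L1Arr ` (\<lambda>y. amp (t y) (\<phi> x y) (l y)) ` Y" for x
    by (auto simp: frame_cmp_main image_image)
  then show ?thesis
    by (auto simp: kan_star_def concept_star_def sup_frame_hom_range[OF r] intro!: restrict_ext)
qed

lemma kan_lower_of_concept: "kan_down (Infty, \<lambda>x\<in>X. L1Arr (m x)) = of_concept (down m)"
proof -
  have "\<Sqinter>\<^bsub>frame_hom (Node (t y)) Infty\<^esub> ((\<lambda>x. limp \<Q> (Node 0) (Node (t y)) Infty
      ((\<lambda>x\<in>X. L1Arr (m x)) x) (PArr (\<phi> x y))) ` X) = L2Arr (down m y)" if y: "y \<in> Y" for y
  proof -
    have r: "frame_arrs (Node (t y)) Infty = range L2Arr"
      using index[OF y] by (auto simp: frame_arrs_def)
    have "(\<lambda>x. limp \<Q> (Node 0) (Node (t y)) Infty ((\<lambda>x\<in>X. L1Arr (m x)) x) (PArr (\<phi> x y))) ` X =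
        L2Arr ` (\<lambda>x. nwa (t y) (m x) (\<phi> x y)) ` X"
      using index[OF y] by (auto simp: limp_frame image_image)
    then show ?thesis using y by (simp add: inf_frame_hom_range[OF r] concept_lower_def)
  qed
  then show ?thesis by (auto simp: kan_lower_def intro!: restrict_ext)
qed

lemma of_concept_inj:
  assumes "of_concept l = of_concept l'" "l \<in> extensional Y" "l' \<in> extensional Y"
  shows "l = l'"
proof (rule extensionalityI[OF assms(2,3)])
  fix y assume "y \<in> Y"
  then show "l y = l' y" using assms(1) by (auto dest!: fun_cong[of _ _ y])
qed

lemma kan_closure_of_concept: "kan_down (kan_up (of_concept l)) = of_concept (down (up l))"
  by (simp only: kan_star_of_concept kan_lower_of_concept)

text \<open>Both \<open>l\<close> and its closure are extensional, so \<open>of_concept\<close> is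
  injective on them and an equation of presheaves can be cancelled to one of functions.\<close>

lemma kan_fixed_of_concept:
  "l \<in> extensional Y \<Longrightarrow> kan_down (kan_up (of_concept l)) = of_concept l \<longleftrightarrow> down (up l) = l"
  unfolding kan_closure_of_concept using of_concept_inj[OF _ concept_extensional(2)] by metis

lemma presheaves_Infty:
  "(Infty, k) \<in> presheaves \<Q> Y (\<lambda>y. Node (t y)) \<longleftrightarrow>
    (\<exists>l\<in>extensional Y. (Infty, k) = of_concept l)"
proof -
  have r: "frame_arrs (Node (t y)) Infty = range L2Arr" if "y \<in> Y" for y
    using index[OF that] by (auto simp: frame_arrs_def)
  show ?thesis
  proof
    assume "(Infty, k) \<in> presheaves \<Q> Y (\<lambda>y. Node (t y))"
    then have k: "k \<in> extensional Y" "\<And>y. y \<in> Y \<Longrightarrow> k y \<in> range L2Arr"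
      by (simp_all add: presheaves_def PiE_iff flip: r)
    \<comment> \<open>All values on \<open>Y\<close> lie in a copy of \<open>'l2\<close>, so
      stripping the constructor recovers the required function.\<close>
    have "(Infty, k) = of_concept (\<lambda>y\<in>Y. the_inv L2Arr (k y))"
      using k by (auto simp: inj_def f_the_inv_into_f intro!: extensionalityI[of k Y])
    then show "\<exists>l\<in>extensional Y. (Infty, k) = of_concept l" by blast
  qed (auto simp: presheaves_def r)
qed

lemma carrier_kan_fibre: "carrier kan_fib = of_concept ` {l \<in> extensional Y. down (up l) = l}"
proof -
  have "a \<in> carrier kan_fib \<longleftrightarrow> (\<exists>l\<in>extensional Y. a = of_concept l \<and> down (up l) = l)" for a
  proof -
    have "a \<in> carrier kan_fib \<longleftrightarrow> fst a = Infty \<and>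
        a \<in> presheaves \<Q> Y (\<lambda>y. Node (t y)) \<and> kan_down (kan_up a) = a"
      by (auto simp: fibre_def kan_fixed_def presheaf_qcat_def)
    also have "\<dots> \<longleftrightarrow> (\<exists>l\<in>extensional Y. a = of_concept l \<and> kan_down (kan_up a) = a)"
      by (metis presheaves_Infty fst_conv prod.collapse)
    finally show ?thesis using kan_fixed_of_concept by metis
  qed
  then show ?thesis by blast
qed

text \<open>The underlying order compares the identity with the presheaf hom. By the universal
  property \<open>le_phom\<close> this means that composing each value of \<open>l\<close> with the
  identity stays below the value of \<open>l'\<close>, which is the pointwise order.\<close>

lemma le_kan_fibre:
  assumes "l \<in> extensional Y" "l' \<in> extensional Y"
  shows "of_concept l \<sqsubseteq>\<^bsub>kan_fib\<^esub> of_concept l' \<longleftrightarrow> pointwise_le Y l l'"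
proof -
  interpret Q: quantaloid \<Q> by (rule quantaloid_frame_quantaloid)
  have tY: "(\<lambda>y. Node (t y)) \<in> Y \<rightarrow> Obj \<Q>" using index by fastforce
  have P: "of_concept k \<in> presheaves \<Q> Y (\<lambda>y. Node (t y))" if "k \<in> extensional Y" for k
    using that presheaves_Infty by blast
  have "of_concept l \<sqsubseteq>\<^bsub>kan_fib\<^esub> of_concept l' \<longleftrightarrow> IdArr \<sqsubseteq>\<^bsub>Hom \<Q> Infty Infty\<^esub>
      qhom (presheaf_qcat \<Q> Y (\<lambda>y. Node (t y))) (of_concept l) (of_concept l')"
    by (simp add: fibre_def underlying_le_def kan_fixed_def presheaf_qcat_def)
  also have "\<dots> \<longleftrightarrow> pointwise_le Y l l'"
    by (subst Q.le_phom[OF tY P P])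
      (auto simp: assms frame_arrs_def frame_cmp_id pointwise_le_def)
  finally show ?thesis .
qed

text \<open>Dropping the second component loses nothing, since in a concept it equals
  \<open>up l\<close>.\<close>

lemma complete_lattice_iso_concepts_fibre:
  "complete_lattice_iso concepts kan_fib (\<lambda>(l, m). of_concept l)"
proof (rule complete_lattice_iso_of_order_iso[OF complete_lattice_concepts])
  show "(.=\<^bsub>kan_fib\<^esub>) = (=)" by (simp add: fibre_def)
  show "bij_betw (\<lambda>(l, m). of_concept l) (carrier concepts) (carrier kan_fib)"
    unfolding bij_betw_def carrier_kan_fibre carrier_concepts
  proof
    show "inj_on (\<lambda>(l, m). of_concept l) {(l, up l) | l. l \<in> extensional Y \<and> down (up l) = l}"
      using of_concept_inj by (auto intro!: inj_onI)
  qed force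
qed (auto simp: carrier_concepts le_concepts le_kan_fibre)

end

end

theorem theorem5p4:
  fixes n :: nat
    and amp :: "nat \<Rightarrow> 'p::complete_lattice \<Rightarrow> 'l2::complete_lattice \<Rightarrow> 'l1::complete_lattice"
    and swa :: "nat \<Rightarrow> 'l1 \<Rightarrow> 'l2 \<Rightarrow> 'p"
    and nwa :: "nat \<Rightarrow> 'l1 \<Rightarrow> 'p \<Rightarrow> 'l2"
    and X :: "'x set" and Y :: "'y set"
    and \<phi> :: "'x \<Rightarrow> 'y \<Rightarrow> 'p"
    and t :: "'y \<Rightarrow> nat"
  assumes "property_oriented_frame n amp swa nwa"
    and "t \<in> Y \<rightarrow> {1..n}"
  shows "complete_lattice_isomorphic
    (property_oriented_concept_lattice amp nwa X Y t \<phi>)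
    (fibre (frame_quantaloid n amp)
       (kan_fixed (frame_quantaloid n amp) X (\<lambda>_. Node 0) Y (\<lambda>y. Node (t y))
          (\<lambda>x y. PArr (\<phi> x y)))
       Infty)"
  unfolding complete_lattice_isomorphic_def
  using property_oriented_frame.complete_lattice_iso_concepts_fibre[OF assms] by blast

end
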